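(* There is an absolute constant $K>0$ such that for any designed rate $R\in(0,1]$ and all sufficiently small $\epsilon>0$ (how small may depend on $R$) there is an infinite family of codes of the form $(\mathsf{C})_\Phi$ (with lengths $n$ tending to infinity), of rate at least $R$ and relative minimum distance greater than $1-R-\epsilon$, over an alphabet $\Phi$ of size at most $2^{K(\log(1/\epsilon))/\epsilon^3}$, i.e. of size $$2^{O\left((\log(1/\epsilon))/\epsilon^3\right)}.$$
   Context: Codes of the form $(\mathsf{C})_\Phi$ are defined as follows. Let $\mathcal{G}=(V':V'',E)$ be a simple bipartite $\Delta$-regular undirected connected graph with $|V'|=|V''|=n>1$ (every edge has one endpoint in $V'$ and one in $V''$). For a vertex $u$, $E(u)$ is the set of edges incident with $u$; an ordering of the vertices is fixed, which induces an ordering of each $E(u)$. For a word $z=(z_e)_{e\in E}$, $(z)_{E(u)}$ is the sub-block of $z$ indexed by $E(u)$. Let $F=\mathrm{GF}(q)$ and let $\mathcal{C}'$ and $\mathcal{C}''$ be nonzero linear codes of length $\Delta$ over $F$, where $\mathcal{C}'$ has dimension $r\Delta$. Define $$\mathsf{C}=(\mathcal{G},\mathcal{C}':\mathcal{C}'')=\{c\in F^{|E|}: (c)_{E(u)}\in\mathcal{C}'\text{ for every }u\in V'\text{ and }(c)_{E(v)}\in\mathcal{C}''\text{ for every }v\in V''\}.$$ Let $\Phi=F^{r\Delta}$, fix a linear one-to-one map $\mathcal{E}:\Phi\to\mathcal{C}'$ over $F$ (hence a bijection), and let $$(\mathsf{C})_\Phi=\Bigl\{\bigl(\mathcal{E}^{-1}((c)_{E(u)})\bigr)_{u\in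 V'}:c\in\mathsf{C}\Bigr\}\subseteq\Phi^n,$$ a code of length $n$ over the alphabet $\Phi$. The rate of a code $\mathcal{A}\subseteq\Phi^n$ is $(\log_{|\Phi|}|\mathcal{A}|)/n$; its relative minimum distance is $1/n$ times the minimum Hamming distance (over the alphabet $\Phi$) between two distinct codewords. *)

theory Defs
  imports Complex_Main "Jordan_Normal_Form.Missing_VectorSpace"
begin

text \<open>An undirected graph is given by its edge set, whose members are two-element
  sets of vertices; edges are therefore never parallel, and loops are excluded by
  bipartiteness.\<close>

definition incident_edges :: "'v set set \<Rightarrow> 'v \<Rightarrow> 'v set set" where
  "incident_edges E u = {e \<in> E. u \<in> e}"

definition neighbours :: "'v set set \<Rightarrow> 'v \<Rightarrow> 'v set" where
  "neighbours E u = {v. {u, v} \<in> E}"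

definition bipartite_regular_graph :: "'v set \<Rightarrow> 'v set \<Rightarrow> 'v set set \<Rightarrow> nat \<Rightarrow> bool" where
  "bipartite_regular_graph V1 V2 E \<Delta> \<longleftrightarrow>
     finite V1 \<and> finite V2 \<and> V1 \<inter> V2 = {} \<and> card V1 = card V2 \<and> card V1 > 1 \<and>
     (\<forall>e\<in>E. \<exists>u\<in>V1. \<exists>v\<in>V2. e = {u, v}) \<and>
     (\<forall>u\<in>V1 \<union> V2. card (incident_edges E u) = \<Delta>) \<and>
     (\<forall>u\<in>V1 \<union> V2. \<forall>v\<in>V1 \<union> V2. (u, v) \<in> {(x, y). {x, y} \<in> E}\<^sup>*)"

text \<open>The vertex ordering is the linear order of the vertex type.  The edges at \<open>u\<close>
  are listed in the order of their other endpoints, so that the sub-block of a word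
  at \<open>u\<close> becomes a vector with coordinates \<open>0, \<dots>, deg u - 1\<close>.\<close>

definition edge_block :: "'v::linorder set set \<Rightarrow> 'v \<Rightarrow> ('v set \<Rightarrow> 'a) \<Rightarrow> nat \<Rightarrow> 'a" where
  "edge_block E u z =
     (\<lambda>i\<in>{..<card (incident_edges E u)}. z {u, sorted_list_of_set (neighbours E u) ! i})"

text \<open>The space of vectors of length \<open>m\<close>: extensional functions on \<open>{..<m}\<close>.\<close>

abbreviation vec_space :: "'a ring \<Rightarrow> nat \<Rightarrow> ('a, nat \<Rightarrow> 'a) module" where
  "vec_space F m \<equiv> ring.func_space F {..<m}"

abbreviation code_space :: "'a ring \<Rightarrow> nat \<Rightarrow> (nat \<Rightarrow> 'a) set \<Rightarrow> ('a, nat \<Rightarrow> 'a) module" where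
  "code_space F m C \<equiv> (vec_space F m)\<lparr>carrier := C\<rparr>"

definition nonzero_linear_code :: "'a ring \<Rightarrow> nat \<Rightarrow> (nat \<Rightarrow> 'a) set \<Rightarrow> bool" where
  "nonzero_linear_code F m C \<longleftrightarrow>
     VectorSpace.subspace F C (vec_space F m) \<and> C \<noteq> {\<zero>\<^bsub>vec_space F m\<^esub>}"

definition graph_code ::
  "'a ring \<Rightarrow> 'v::linorder set \<Rightarrow> 'v set \<Rightarrow> 'v set set \<Rightarrow> (nat \<Rightarrow> 'a) set \<Rightarrow> (nat \<Rightarrow> 'a) set
    \<Rightarrow> ('v set \<Rightarrow> 'a) set" where
  "graph_code F V1 V2 E C1 C2 =
     {c \<in> E \<rightarrow>\<^sub>E carrier F.
        (\<forall>u\<in>V1. edge_block E u c \<in> C1) \<and> (\<forall>v\<in>V2. edge_block E v c \<in> C2)}"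

text \<open>The alphabet $\Phi = F^k$, where $k = r\Delta$ is the dimension of the first
  constituent code.\<close>

abbreviation alphabet :: "'a ring \<Rightarrow> nat \<Rightarrow> (nat \<Rightarrow> 'a) set" where
  "alphabet F k \<equiv> carrier (vec_space F k)"

definition folded_code ::
  "'a ring \<Rightarrow> nat \<Rightarrow> ((nat \<Rightarrow> 'a) \<Rightarrow> nat \<Rightarrow> 'a) \<Rightarrow> 'v::linorder set \<Rightarrow> 'v set \<Rightarrow> 'v set set
    \<Rightarrow> (nat \<Rightarrow> 'a) set \<Rightarrow> (nat \<Rightarrow> 'a) set \<Rightarrow> ('v \<Rightarrow> nat \<Rightarrow> 'a) set" where
  "folded_code F k enc V1 V2 E C1 C2 =
     (\<lambda>c. \<lambda>u\<in>V1. inv_into (alphabet F k) enc (edge_block E u c)) ` graph_code F V1 V2 E C1 C2"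

text \<open>\<open>A\<close> is a code of the form $(\mathsf{C})_\Phi$ over $\Phi = F^k$.  Its coordinates
  are indexed by the left vertex set \<open>V1\<close>, so its length is \<open>card V1\<close>.\<close>

definition is_folded_code ::
  "'a ring \<Rightarrow> nat \<Rightarrow> 'v::linorder set \<Rightarrow> ('v \<Rightarrow> nat \<Rightarrow> 'a) set \<Rightarrow> bool" where
  "is_folded_code F k V1 A \<longleftrightarrow>
     field F \<and> finite (carrier F) \<and>
     (\<exists>V2 E \<Delta> C1 C2 enc.
        bipartite_regular_graph V1 V2 E \<Delta> \<and>
        nonzero_linear_code F \<Delta> C1 \<and> nonzero_linear_code F \<Delta> C2 \<and>
        vectorspace.dim F (code_space F \<Delta> C1) = k \<and>
        linear_map F (vec_space F k) (code_space F \<Delta> C1) enc \<and>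
        inj_on enc (alphabet F k) \<and>
        A = folded_code F k enc V1 V2 E C1 C2)"

text \<open>Codes over an alphabet \<open>\<Phi>\<close> whose coordinates are indexed by a finite set \<open>I\<close>.\<close>

definition code_rate :: "'s set \<Rightarrow> 'i set \<Rightarrow> ('i \<Rightarrow> 's) set \<Rightarrow> real" where
  "code_rate \<Phi> I A = log (real (card \<Phi>)) (real (card A)) / real (card I)"

definition hamming_dist :: "'i set \<Rightarrow> ('i \<Rightarrow> 's) \<Rightarrow> ('i \<Rightarrow> 's) \<Rightarrow> nat" where
  "hamming_dist I x y = card {i \<in> I. x i \<noteq> y i}"

text \<open>Meaningful only for codes with at least two codewords, which a positive rate
  guarantees.\<close>

definition rel_min_dist :: "'i set \<Rightarrow> ('i \<Rightarrow> 's) set \<Rightarrow> real" where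
  "rel_min_dist I A =
     real (Min {hamming_dist I x y | x y. x \<in> A \<and> y \<in> A \<and> x \<noteq> y}) / real (card I)"

end

theory Submission
  imports Defs "HOL-Combinatorics.Permutations" "HOL-Number_Theory.Cong"
    "HOL-Computational_Algebra.Primes" "HOL-Computational_Algebra.Polynomial"
begin

text \<open>
  The graphs are random lifts of \<open>K\<^bsub>\<Delta>,\<Delta>\<^esub>\<close> with \<open>\<Delta>\<close> of order \<open>1/\<epsilon>\<^sup>3\<close>, the constituent codes are MDS
  codes over a prime field of size polynomial in \<open>\<Delta>\<close>, with relative distances about \<open>\<theta> = \<epsilon>/4\<close>
  and \<open>\<delta> = (1-R)(1-\<theta>)\<close>.  If two codewords differ exactly on the left vertices \<open>S\<close>, and \<open>T\<close> is the
  set of right vertices where they differ, then at least \<open>\<theta>\<Delta>|S|\<close> and at least \<open>\<delta>\<Delta>|T|\<close> edges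
  join \<open>S\<close> and \<open>T\<close>.  With high probability a lift admits no such pair with \<open>|S| \<le> (1-R-\<epsilon>)n\<close>:
  when \<open>T\<close> has density of order \<open>\<theta>\<close>, a Chernoff bound with exponent of order
  \<open>\<Delta>\<theta>\<epsilon>\<^sup>2n\<close> beats the \<open>4\<^sup>n\<close> pairs, and for sparser \<open>T\<close> the \<open>\<theta>\<Delta>|S|\<close> edges are unlikely enough to
  pay for the choice of \<open>S\<close> and \<open>T\<close>.  No spectral bound is needed.  The same estimate with
  \<open>|S| \<le> n/2\<close> and \<open>\<delta> = 1\<close> excludes small components, so that the graph is connected.
\<close>

section \<open>Random lifts\<close>

text \<open>The rate is measured against the folded alphabet of size p^k, so redundancy of the left
  code is normalised away: n k free symbols on the left minus n r checks on the right give rate at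
  least 1 - r/k. A positive left distance \<theta> therefore costs only the factor 1 - \<theta> in
  \<delta>, because r may be about (1-R)k while the right distance is compared with the degree. With
  \<theta> = \<epsilon>/4 the value \<delta> still exceeds the target 1-R-\<epsilon> by
  3\<epsilon>/4 or more. This fixes the degree: the squared gap contributes \<epsilon>^2, the
  density of the right set contributes \<theta>, and their product with the degree has to beat an
  entropy of constant order per vertex. The deviation bound from the right side has an exponent
  proportional to |T|, while the choice of S may cost order n; this is the obstacle for sparse T and
  the reason for giving the left code some distance at all. The logarithm in the alphabet size is
  log p, which is O(log(1/\<epsilon>)) because a prime polynomial in the degree is available. Edge
  counts of a random matching are not independent, so the deviation bounds start from a comparison
  with independent choices.\<close>

lemma card_permutes_image_subset_insert:
  assumes U: "finite U" and "K \<subseteq> U" "B \<subseteq> U" and a: "a \<in> U - K"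
  shows "real (card {p. p permutes U \<and> p ` insert a K \<subseteq> B}) * real (card U)
    \<le> real (card B) * real (card {p. p permutes U \<and> p ` K \<subseteq> B})"
proof -
  define P where "P K = {p. p permutes U \<and> p ` K \<subseteq> B}" for K
  have fP: "finite (P K)" for K
    using finite_permutations[OF U] by (rule rev_finite_subset) (auto simp: P_def)
  have fB: "finite B" and fK: "finite K" using assms finite_subset by auto
  have count: "card {a' \<in> U - K. p a' \<in> B} + card K = card B" if "p \<in> P K" for p
  proof -
    have p: "p permutes U" "p ` K \<subseteq> B" using that by (auto simp: P_def)
    have "{a' \<in> U - K. p a' \<in> B} \<union> K = inv_into UNIV p ` B"
    proof (intro equalityI subsetI)
      fix x assume "x \<in> {a' \<in> U - K. p a' \<in> B} \<union> K"
      then have "p x \<in> B" using p(2) by auto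
      then show "x \<in> inv_into UNIV p ` B" using p(1) by (metis image_eqI permutes_inverses(2))
    next
      fix x assume "x \<in> inv_into UNIV p ` B"
      then show "x \<in> {a' \<in> U - K. p a' \<in> B} \<union> K"
        using p(1) permutes_inv[OF p(1)] assms(3)
        by (auto simp: permutes_inverses permutes_in_image subset_iff)
    qed
    moreover have "card (inv_into UNIV p ` B) = card B"
      using permutes_inj[OF permutes_inv[OF p(1)]] by (intro card_image) (auto intro: inj_on_subset)
    moreover have "card ({a' \<in> U - K. p a' \<in> B} \<union> K) = card {a' \<in> U - K. p a' \<in> B} + card K"
      using U fK by (intro card_Un_disjoint) auto
    ultimately show ?thesis by simp
  qed
  have ins: "{p \<in> P K. p a' \<in> B} = P (insert a' K)" for a'
    by (auto simp: P_def)
  \<comment> \<open>Composing with the transposition of a and a' fixes K pointwise, so the count is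
    the same for all a'. Counting the pairs (p, a') in two ways then yields the exact ratio (|B| -
    |K|) / (|U| - |K|).\<close>
  have sym: "card (P (insert a' K)) = card (P (insert a K))" if "a' \<in> U - K" for a'
  proof -
    let ?t = "transpose a a'"
    have t: "?t permutes U" using a that by (intro permutes_swap_id) auto
    have tK: "?t x = x" if "x \<in> K" for x using a \<open>a' \<in> U - K\<close> that by (intro transpose_apply_other) auto
    have "bij_betw (\<lambda>p. p \<circ> ?t) (P (insert a' K)) (P (insert a K))"
      by (rule bij_betw_byWitness[where f' = "\<lambda>p. p \<circ> ?t"])
        (auto simp: P_def comp_assoc permutes_compose[OF t] tK image_subset_iff)
    then show ?thesis by (rule bij_betw_same_card)
  qed
  have "(card U - card K) * card (P (insert a K)) = (\<Sum>a'\<in>U - K. card (P (insert a' K)))"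
    using sym assms(2) fK by (simp add: card_Diff_subset)
  also have "\<dots> = (\<Sum>a'\<in>U - K. \<Sum>p\<in>P K. if p a' \<in> B then 1 else 0)"
    using fP by (simp add: sum.If_cases Int_def flip: ins)
  also have "\<dots> = (\<Sum>p\<in>P K. card {a' \<in> U - K. p a' \<in> B})"
    using U by (subst sum.swap) (simp add: sum.If_cases Int_def)
  also have "\<dots> = (\<Sum>p\<in>P K. card B - card K)"
  proof (intro sum.cong refl)
    fix p assume "p \<in> P K"
    then show "card {a' \<in> U - K. p a' \<in> B} = card B - card K"
      using count[of p] by simp
  qed
  finally have eq: "(card U - card K) * card (P (insert a K)) = card (P K) * (card B - card K)"
    by simp
  \<comment> \<open>The exact ratio (b - k) / (m - k) is at most b / m because b <= m. When no
    permutation maps K into B, k may exceed b and the subtraction in \<open>eq\<close> truncates;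
    hence the case split.\<close>
  have "real (card (P (insert a K))) * real (card U) \<le> real (card B) * real (card (P K))"
  proof (cases "P K = {}")
    case True
    then have "P (insert a K) = {}" by (auto simp: P_def)
    then show ?thesis by simp
  next
    case False
    then have kb: "card K \<le> card B" using count by force
    have bm: "card B \<le> card U" using assms by (simp add: card_mono)
    have km: "card K < card U" using assms by (intro psubset_card_mono) auto
    define k b m c c' where "k = real (card K)" "b = real (card B)" "m = real (card U)"
      "c = real (card (P K))" "c' = real (card (P (insert a K)))"
    note defs = this
    have "(m - k) * c' = c * (b - k)"
      using arg_cong[OF eq, of real] kb km by (simp add: defs of_nat_diff)
    moreover have "(b - k) * m \<le> b * (m - k)"
      using bm mult_left_mono[of b m k] by (simp add: defs algebra_simps)
    ultimately have "((m - k) * c') * m \<le> c * (b * (m - k))"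
      using mult_left_mono[of "(b - k) * m" "b * (m - k)" c] by (simp add: defs mult.assoc)
    then have "(m - k) * (c' * m) \<le> (m - k) * (b * c)" by (simp only: mult_ac)
    then have "c' * m \<le> b * c" using km by (simp add: defs)
    then show ?thesis by (simp add: defs)
  qed
  then show ?thesis by (simp only: P_def)
qed

text \<open>Each further point of K costs a factor of at most |B| / |U|, so a random permutation is
  no more likely to send K into B than independent uniform values would be.\<close>

lemma card_permutes_image_subset:
  assumes U: "finite U" and "B \<subseteq> U" and K: "K \<subseteq> U"
  shows "real (card {p. p permutes U \<and> p ` K \<subseteq> B}) * real (card U) ^ card K
    \<le> fact (card U) * real (card B) ^ card K"
proof -
  have "finite K" using U K finite_subset by blast
  then show ?thesis using K
  proof (induction K rule: finite_induct)
    case empty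
    then show ?case using card_permutations[OF refl U] by simp
  next
    case (insert a K)
    let ?c = "\<lambda>K. real (card {p. p permutes U \<and> p ` K \<subseteq> B})"
    have "?c (insert a K) * real (card U) ^ card (insert a K)
        = (?c (insert a K) * real (card U)) * real (card U) ^ card K"
      using insert by simp
    also have "\<dots> \<le> (real (card B) * ?c K) * real (card U) ^ card K"
      by (intro mult_right_mono card_permutes_image_subset_insert) (use insert assms in auto)
    also have "\<dots> \<le> real (card B) * (fact (card U) * real (card B) ^ card K)"
      using insert by (simp add: mult.assoc mult_left_mono)
    finally show ?case using insert by (simp add: mult_ac)
  qed
qed

lemma sum_Pow_power_card:
  assumes "finite X"
  shows "(\<Sum>K\<in>Pow X. x ^ card K) = (1 + x :: 'a :: comm_semiring_1) ^ card X"
  using prod_add[OF assms, of "\<lambda>_. x" "\<lambda>_. 1"] by (simp add: add.commute)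

text \<open>Hoeffding's comparison of the hypergeometric with the binomial distribution.\<close>

lemma permutations_mgf_bound:
  fixes x :: real
  assumes U: "finite U" "U \<noteq> {}" and A: "A \<subseteq> U" and B: "B \<subseteq> U" and x: "x \<ge> 0"
  shows "(\<Sum>p | p permutes U. (1 + x) ^ card {a \<in> A. p a \<in> B})
    \<le> fact (card U) * (1 + x * card B / card U) ^ card A"
proof -
  have fA: "finite A" using U A finite_subset by blast
  have fP: "finite {p. p permutes U}" using finite_permutations[OF U(1)] .
  have m: "real (card U) > 0" using U by (simp add: card_gt_0_iff)
  have "(\<Sum>p | p permutes U. (1 + x) ^ card {a \<in> A. p a \<in> B})
      = (\<Sum>p | p permutes U. \<Sum>K\<in>Pow {a \<in> A. p a \<in> B}. x ^ card K)"
    using fA by (subst sum_Pow_power_card) auto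
  \<comment> \<open>Extending the inner sum to all subsets of A makes its range independent of p.
    After the exchange of sums, each K is bounded separately, with the sign secured by x >=
    0.\<close>
  also have "\<dots> = (\<Sum>p | p permutes U. \<Sum>K\<in>Pow A. if p ` K \<subseteq> B then x ^ card K else 0)"
    using fA by (intro sum.cong refl sum.mono_neutral_cong_left) auto
  also have "\<dots> = (\<Sum>K\<in>Pow A. x ^ card K * card {p. p permutes U \<and> p ` K \<subseteq> B})"
    using fP by (subst sum.swap) (auto simp: sum.If_cases Int_def mult.commute)
  also have "\<dots> \<le> (\<Sum>K\<in>Pow A. x ^ card K * (fact (card U) * (card B / card U) ^ card K))"
  proof (intro sum_mono mult_left_mono)
    fix K assume "K \<in> Pow A"
    then have "real (card {p. p permutes U \<and> p ` K \<subseteq> B}) * real (card U) ^ card K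
      \<le> fact (card U) * real (card B) ^ card K"
      using A by (intro card_permutes_image_subset U B) auto
    then show "real (card {p. p permutes U \<and> p ` K \<subseteq> B})
      \<le> fact (card U) * (card B / card U) ^ card K"
      using m by (simp add: power_divide pos_le_divide_eq)
  qed (use x in auto)
  also have "\<dots> = fact (card U) * (\<Sum>K\<in>Pow A. (x * card B / card U) ^ card K)"
    by (simp add: sum_distrib_left power_mult_distrib power_divide mult_ac)
  finally show ?thesis using fA by (simp add: sum_Pow_power_card)
qed

section \<open>Edge counts in random lifts\<close>

text \<open>A vertex \<open>u < \<Delta>m\<close> of either side lies in the fibre \<open>u div m\<close> over a vertex of \<open>K\<^bsub>\<Delta>,\<Delta>\<^esub>\<close>, at
  position \<open>u mod m\<close>.  In a lift the fibres \<open>i\<close> and \<open>j\<close> are matched by the permutation \<open>\<pi> (i, j)\<close>;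
  it is therefore automatically simple and \<open>\<Delta>\<close>-regular.\<close>

definition lift_adj :: "nat \<Rightarrow> (nat \<times> nat \<Rightarrow> nat \<Rightarrow> nat) \<Rightarrow> nat \<Rightarrow> nat \<Rightarrow> bool" where
  "lift_adj m \<pi> u v \<longleftrightarrow> \<pi> (u div m, v div m) (u mod m) = v mod m"

definition lift_edges :: "nat \<Rightarrow> (nat \<times> nat \<Rightarrow> nat \<Rightarrow> nat) \<Rightarrow> nat set \<Rightarrow> nat set \<Rightarrow> nat" where
  "lift_edges m \<pi> S T = card {(u, v). u \<in> S \<and> v \<in> T \<and> lift_adj m \<pi> u v}"

definition lifts :: "nat \<Rightarrow> nat \<Rightarrow> (nat \<times> nat \<Rightarrow> nat \<Rightarrow> nat) set" where
  "lifts D m = (\<Pi>\<^sub>E p\<in>{..<D} \<times> {..<D}. {\<sigma>. \<sigma> permutes {..<m}})"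

definition fibre :: "nat \<Rightarrow> nat set \<Rightarrow> nat \<Rightarrow> nat set" where
  "fibre m S i = {a \<in> {..<m}. i * m + a \<in> S}"

lemma fibre_subset: "fibre m S i \<subseteq> {..<m}"
  by (auto simp: fibre_def)

lemma finite_lifts: "finite (lifts D m)"
  by (auto simp: lifts_def intro!: finite_PiE finite_permutations)

lemma card_lifts: "card (lifts D m) = fact m ^ (D * D)"
  by (simp add: lifts_def card_PiE card_permutations[OF refl])

lemma sum_card_fibre:
  assumes "m > 0" "S \<subseteq> {..<D * m}"
  shows "(\<Sum>i<D. card (fibre m S i)) = card S"
proof -
  have "bij_betw (\<lambda>(i, a). i * m + a) (SIGMA i:{..<D}. fibre m S i) S"
  proof (rule bij_betw_byWitness[where f' = "\<lambda>u. (u div m, u mod m)"])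
    show "(\<lambda>u. (u div m, u mod m)) ` S \<subseteq> (SIGMA i:{..<D}. fibre m S i)"
      using assms by (auto simp: fibre_def less_mult_imp_div_less)
  qed (use assms in \<open>auto simp: fibre_def\<close>)
  then have "card (SIGMA i:{..<D}. fibre m S i) = card S"
    by (rule bij_betw_same_card)
  then show ?thesis
    by (simp add: finite_subset[OF fibre_subset])
qed

lemma lift_edges_eq_sum_fibres:
  assumes "m > 0" and S: "S \<subseteq> {..<D * m}" and T: "T \<subseteq> {..<D * m}" and \<pi>: "\<pi> \<in> lifts D m"
  shows "lift_edges m \<pi> S T =
    (\<Sum>p\<in>{..<D} \<times> {..<D}. card {a \<in> fibre m S (fst p). \<pi> p a \<in> fibre m T (snd p)})"
proof -
  have perm: "\<pi> (i, j) a < m" if "i < D" "j < D" "a < m" for i j a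
  proof -
    have "\<pi> (i, j) permutes {..<m}" using \<pi> that by (auto simp: lifts_def)
    then show ?thesis using that permutes_in_image by fastforce
  qed
  let ?E = "{(u, v). u \<in> S \<and> v \<in> T \<and> lift_adj m \<pi> u v}"
  let ?X = "SIGMA p:{..<D} \<times> {..<D}. {a \<in> fibre m S (fst p). \<pi> p a \<in> fibre m T (snd p)}"
  have "bij_betw (\<lambda>(p, a). (fst p * m + a, snd p * m + \<pi> p a)) ?X ?E"
  proof (rule bij_betw_byWitness[where f' = "\<lambda>(u, v). ((u div m, v div m), u mod m)"])
    show "(\<lambda>(p, a). (fst p * m + a, snd p * m + \<pi> p a)) ` ?X \<subseteq> ?E"
      using perm by (auto simp: fibre_def lift_adj_def)
    show "(\<lambda>(u, v). ((u div m, v div m), u mod m)) ` ?E \<subseteq> ?X"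
      using S T \<open>m > 0\<close> by (auto simp: fibre_def lift_adj_def less_mult_imp_div_less subset_iff)
  qed (use perm in \<open>auto simp: fibre_def lift_adj_def\<close>)
  then have "card ?X = card ?E" by (rule bij_betw_same_card)
  then show ?thesis
    by (simp add: lift_edges_def finite_subset[OF fibre_subset])
qed

text \<open>The permutations of different fibre pairs are independent, so the moment factors. The
  products of fibre sizes add up to |S||T|, and the bound does not depend on how S and T are spread
  over the fibres: it is the one satisfied by |S||T| independent edges of probability 1/m.\<close>

lemma lifts_mgf_bound:
  fixes x :: real
  assumes m: "m > 0" and S: "S \<subseteq> {..<D * m}" and T: "T \<subseteq> {..<D * m}" and x: "x \<ge> 0"
  shows "(\<Sum>\<pi>\<in>lifts D m. (1 + x) ^ lift_edges m \<pi> S T)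
    \<le> card (lifts D m) * exp (x * card S * card T / m)"
proof -
  let ?I = "{..<D} \<times> {..<D}"
  let ?P = "{\<sigma>. \<sigma> permutes {..<m}}"
  let ?A = "\<lambda>p. fibre m S (fst p)" and ?B = "\<lambda>p. fibre m T (snd p)"
  have "(\<Sum>\<pi>\<in>lifts D m. (1 + x) ^ lift_edges m \<pi> S T)
      = (\<Sum>\<pi>\<in>lifts D m. \<Prod>p\<in>?I. (1 + x) ^ card {a \<in> ?A p. \<pi> p a \<in> ?B p})"
    using m S T by (intro sum.cong refl) (simp add: lift_edges_eq_sum_fibres power_sum)
  also have "\<dots> = (\<Prod>p\<in>?I. \<Sum>\<sigma>\<in>?P. (1 + x) ^ card {a \<in> ?A p. \<sigma> a \<in> ?B p})"
    unfolding lifts_def by (rule prod_sum_PiE[symmetric]) (auto intro: finite_permutations)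
  also have "\<dots> \<le> (\<Prod>p\<in>?I. fact m * exp (x * card (?A p) * card (?B p) / m))"
  proof (intro prod_mono conjI sum_nonneg)
    fix p assume "p \<in> ?I"
    have "(\<Sum>\<sigma>\<in>?P. (1 + x) ^ card {a \<in> ?A p. \<sigma> a \<in> ?B p})
      \<le> fact m * (1 + x * card (?B p) / m) ^ card (?A p)"
      using permutations_mgf_bound[of "{..<m}" "?A p" "?B p" x] m x by (auto simp: fibre_subset)
    also have "\<dots> \<le> fact m * exp (x * card (?B p) / m) ^ card (?A p)"
      using x by (intro mult_left_mono power_mono exp_ge_add_one_self) auto
    also have "exp (x * card (?B p) / m) ^ card (?A p) = exp (x * card (?A p) * card (?B p) / m)"
      by (simp flip: exp_of_nat_mult add: mult_ac)
    finally show "(\<Sum>\<sigma>\<in>?P. (1 + x) ^ card {a \<in> ?A p. \<sigma> a \<in> ?B p})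
      \<le> fact m * exp (x * card (?A p) * card (?B p) / m)" .
  qed (use x in auto)
  also have "\<dots> = fact m ^ (D * D) * exp (\<Sum>p\<in>?I. x * card (?A p) * card (?B p) / m)"
    by (simp add: prod.distrib exp_sum)
  also have "(\<Sum>p\<in>?I. x * card (?A p) * card (?B p) / m)
      = x * (\<Sum>p\<in>?I. real (card (?A p)) * card (?B p)) / m"
    by (simp add: sum_distrib_left sum_divide_distrib mult_ac)
  also have "(\<Sum>p\<in>?I. real (card (?A p)) * card (?B p)) = real (card S) * real (card T)"
    by (simp add: sum_product sum.cartesian_product case_prod_unfold
        flip: sum_card_fibre[OF m S] sum_card_fibre[OF m T])
  finally show ?thesis by (simp add: card_lifts mult.assoc)
qed

text \<open>Markov's inequality for the exponential moment. The parameter x stays free: small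
  deviations for dense T call for a small x, large ones for sparse T for a large x.\<close>

lemma card_lifts_edges_ge:
  fixes x k :: real
  assumes "m > 0" "S \<subseteq> {..<D * m}" "T \<subseteq> {..<D * m}" "x \<ge> 0"
  shows "card {\<pi> \<in> lifts D m. real (lift_edges m \<pi> S T) \<ge> k}
    \<le> card (lifts D m) * exp (x * card S * card T / m - k * ln (1 + x))"
proof -
  let ?B = "{\<pi> \<in> lifts D m. real (lift_edges m \<pi> S T) \<ge> k}"
  have fin: "finite (lifts D m)" by (rule finite_lifts)
  have "real (card ?B) * exp (k * ln (1 + x)) = (\<Sum>\<pi>\<in>?B. exp (k * ln (1 + x)))" by simp
  also have "\<dots> \<le> (\<Sum>\<pi>\<in>?B. (1 + x) ^ lift_edges m \<pi> S T)"
  proof (rule sum_mono)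
    fix \<pi> assume "\<pi> \<in> ?B"
    then have "exp (k * ln (1 + x)) \<le> exp (real (lift_edges m \<pi> S T) * ln (1 + x))"
      using assms by (auto intro!: mult_right_mono)
    also have "\<dots> = (1 + x) ^ lift_edges m \<pi> S T"
      using assms by (simp add: exp_of_nat_mult)
    finally show "exp (k * ln (1 + x)) \<le> (1 + x) ^ lift_edges m \<pi> S T" .
  qed
  also have "\<dots> \<le> (\<Sum>\<pi>\<in>lifts D m. (1 + x) ^ lift_edges m \<pi> S T)"
    using fin assms by (intro sum_mono2) auto
  also have "\<dots> \<le> card (lifts D m) * exp (x * card S * card T / m)"
    by (rule lifts_mgf_bound) fact+
  finally show ?thesis by (simp add: exp_diff field_simps)
qed

lemma lift_edges_le:
  assumes "m > 0" "S \<subseteq> {..<D * m}" "T \<subseteq> {..<D * m}" "\<pi> \<in> lifts D m"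
  shows "lift_edges m \<pi> S T \<le> D * card S"
proof -
  have "lift_edges m \<pi> S T \<le> (\<Sum>p\<in>{..<D} \<times> {..<D}. card (fibre m S (fst p)))"
    unfolding lift_edges_eq_sum_fibres[OF assms]
    by (intro sum_mono card_mono) (auto intro: finite_subset[OF fibre_subset])
  also have "\<dots> = (\<Sum>i<D. \<Sum>j<D. card (fibre m S i))"
    by (simp only: sum.cartesian_product case_prod_unfold)
  also have "\<dots> = D * card S"
    using sum_card_fibre[OF assms(1,2)] by (simp flip: sum_distrib_left)
  finally show ?thesis .
qed

section \<open>Union bound over pairs of vertex sets\<close>

lemma binomial_mult_power_le_exp:
  assumes "n > 0"
  shows "real (n choose s) * (s / n) ^ s \<le> exp s"
proof (cases "s \<le> n")
  case True
  have "real (n choose s) * (s / n) ^ s \<le> (\<Sum>k\<le>n. real (n choose k) * (s / n) ^ k)"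
    by (rule member_le_sum) (use True in auto)
  also have "\<dots> = (1 + s / n) ^ n"
    using binomial_ring[of "real s / n" 1 n] by (simp add: add.commute)
  also have "\<dots> \<le> exp (s / n) ^ n"
    by (intro power_mono exp_ge_add_one_self) auto
  also have "\<dots> = exp s"
    using assms by (simp flip: exp_of_nat_mult)
  finally show ?thesis .
qed (simp add: binomial_eq_0)

text \<open>Shape of the failure probability in the union bound over sparse sets, chosen so that
  the sum over all nonempty subsets stays bounded independently of \<open>n\<close>.\<close>

definition subset_weight :: "nat \<Rightarrow> nat \<Rightarrow> real" where
  "subset_weight n s = exp (- real s * (3 + ln (n / s)))"

lemma sum_subset_weight_le:
  assumes "n > 0"
  shows "(\<Sum>S\<in>Pow {..<n} - {{}}. subset_weight n (card S)) \<le> 1 / 4"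
proof -
  have "(\<Sum>S\<in>Pow {..<n} - {{}}. subset_weight n (card S))
      = (\<Sum>s\<in>{1..n}. \<Sum>S | S \<in> Pow {..<n} - {{}} \<and> card S = s. subset_weight n (card S))"
  proof (rule sum.group[symmetric])
    show "card ` (Pow {..<n} - {{}}) \<subseteq> {1..n}"
      using card_mono[of "{..<n}"] by (auto simp: Suc_le_eq card_gt_0_iff finite_subset)
  qed auto
  also have "\<dots> = (\<Sum>s\<in>{1..n}. real (n choose s) * subset_weight n s)"
  proof (rule sum.cong[OF refl])
    fix s assume "s \<in> {1..n}"
    then have "{S. S \<in> Pow {..<n} - {{}} \<and> card S = s} = {S. S \<subseteq> {..<n} \<and> card S = s}"
      by auto
    then show "(\<Sum>S | S \<in> Pow {..<n} - {{}} \<and> card S = s. subset_weight n (card S))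
        = real (n choose s) * subset_weight n s"
      using n_subsets[of "{..<n}" s] by simp
  qed
  also have "\<dots> \<le> (\<Sum>s\<in>{1..n}. (1 / 5) ^ s)"
  proof (rule sum_mono)
    fix s assume s: "s \<in> {1..n}"
    have "ln (real n / real s) = - ln (real s / real n)"
      using s assms by (simp add: ln_div)
    \<comment> \<open>The factor (s/n)^s absorbs the number of s-subsets up to e^s. What remains is
      e^(-2s) <= 5^(-s), and these terms sum to at most 1/4 from s = 1 on.\<close>
    then have "subset_weight n s = exp (- 3 * real s) * (s / n) ^ s"
      using s assms by (simp add: subset_weight_def algebra_simps exp_diff exp_minus flip: exp_of_nat_mult)
        (simp add: exp_diff exp_minus exp_of_nat_mult exp_add divide_simps)
    then have "real (n choose s) * subset_weight n s
        = exp (- 3 * real s) * (real (n choose s) * (s / n) ^ s)" by simp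
    also have "\<dots> \<le> exp (- 3 * real s) * exp s"
      using assms by (intro mult_left_mono binomial_mult_power_le_exp) auto
    also have "\<dots> = exp (- 2) ^ s"
      by (simp flip: exp_add exp_of_nat_mult)
    also have "\<dots> \<le> (1 / 5) ^ s"
    proof (rule power_mono)
      have "(5 :: real) \<le> (1 + 1 + 1 / 2) ^ 2" by (simp add: power2_eq_square)
      also have "\<dots> \<le> exp 1 ^ 2"
        using exp_lower_Taylor_quadratic[of 1] by (intro power_mono) auto
      finally have "5 \<le> exp (2 :: real)" by (simp flip: exp_of_nat_mult)
      then show "exp (- 2) \<le> 1 / (5 :: real)" by (simp add: exp_minus divide_simps)
    qed simp
    finally show "real (n choose s) * subset_weight n s \<le> (1 / 5) ^ s" .
  qed
  also have "\<dots> \<le> 1 / 4"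
    using sum_gp[of "1 / 5 :: real" 1 n] by (auto simp: field_simps)
  finally show ?thesis .
qed

text \<open>In the union bound below, \<open>gap\<close> pays for the sets \<open>T\<close> of density at least \<open>\<theta>/9\<close> and
  \<open>degree\<close> for the sparser ones.\<close>

locale lift_params =
  fixes D m :: nat and a d \<theta> :: real
  assumes m: "m > 0" and D: "D > 1"
    and a: "0 < a" "a < d" and d: "d \<le> 1" and \<theta>: "0 < \<theta>" "\<theta> \<le> 1"
    and gap: "108 \<le> D * \<theta> * (d - a)\<^sup>2"
    and degree: "(1 + 1 / d) * (3 + ln (1 / \<theta>)) + ln (1 / d) \<le> \<theta> * D / 2"
begin

abbreviation "n \<equiv> D * m"

definition event :: "nat set \<Rightarrow> nat set \<Rightarrow> (nat \<times> nat \<Rightarrow> nat \<Rightarrow> nat) set" where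
  "event S T = {\<pi> \<in> lifts D m. d * D * card T \<le> lift_edges m \<pi> S T \<and>
     \<theta> * D * card S \<le> lift_edges m \<pi> S T}"

lemma n_pos: "n > 0" using m D by simp

text \<open>The demand at T drives the bound: as |S| <= a n, at most a D |T| edges are expected,
  while d D |T| are required.\<close>

lemma card_event_dense:
  assumes S: "S \<subseteq> {..<n}" "card S \<le> a * n" and T: "T \<subseteq> {..<n}" "\<theta> * n \<le> 9 * card T"
  shows "card (event S T) \<le> card (lifts D m) * exp (- 3 * real n)"
proof -
  \<comment> \<open>After ln (1 + x) >= x - x^2 the exponent per D |T| is -(d - a) x + d x^2. This x
    minimises it, with value -(d - a)^2 / (4 d).\<close>
  define x where "x = (d - a) / (2 * d)"
  have x: "0 < x" "x \<le> 1" using a by (auto simp: x_def)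
  have "real (card (event S T)) \<le> card {\<pi> \<in> lifts D m. lift_edges m \<pi> S T \<ge> d * D * card T}"
    by (intro of_nat_mono card_mono) (auto simp: event_def finite_lifts)
  also have "\<dots> \<le> card (lifts D m) * exp (x * card S * card T / m - d * D * card T * ln (1 + x))"
    using m S T x by (intro card_lifts_edges_ge) auto
  also have "\<dots> \<le> card (lifts D m) * exp (- 3 * real n)"
  proof -
    have "x * card S * card T / m \<le> x * (a * n) * card T / m"
      using x S by (intro divide_right_mono mult_right_mono mult_left_mono) auto
    also have "\<dots> = D * card T * (x * a)" using m by simp
    finally have 1: "x * card S * card T / m \<le> D * card T * (x * a)" .
    have "d * D * card T * (x - x\<^sup>2) \<le> d * D * card T * ln (1 + x)"
      using x a ln_one_plus_pos_lower_bound[of x] by (intro mult_left_mono) auto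
    with 1 have "x * card S * card T / m - d * D * card T * ln (1 + x)
        \<le> D * card T * (x * a - d * (x - x\<^sup>2))"
      by (simp add: algebra_simps)
    also have "x * a - d * (x - x\<^sup>2) = - ((d - a)\<^sup>2 / (4 * d))"
      using a by (simp add: x_def field_simps power2_eq_square)
    also have "D * card T * - ((d - a)\<^sup>2 / (4 * d)) \<le> D * card T * - ((d - a)\<^sup>2 / 4)"
    proof (intro mult_left_mono)
      have "(d - a)\<^sup>2 / 4 \<le> (d - a)\<^sup>2 / (4 * d)"
        using a d by (intro divide_left_mono) auto
      then show "- ((d - a)\<^sup>2 / (4 * d)) \<le> - ((d - a)\<^sup>2 / 4)" by simp
    qed simp
    also have "\<dots> \<le> - 3 * real n"
    proof -
      \<comment> \<open>The constant is 4 * 9 * 3: the quarter in the exponent, the density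
        \<theta>/9 of T, and the required 3 n.\<close>
      have "108 * real n \<le> D * \<theta> * (d - a)\<^sup>2 * n"
        using gap by (intro mult_right_mono) auto
      also have "\<dots> = D * (d - a)\<^sup>2 * (\<theta> * n)" by simp
      also have "\<dots> \<le> D * (d - a)\<^sup>2 * (9 * card T)"
        using T by (intro mult_left_mono) auto
      finally show ?thesis by (simp add: algebra_simps)
    qed
    finally show ?thesis by (simp add: mult_left_mono)
  qed
  finally show ?thesis .
qed

text \<open>The demand at S drives the bound: \<theta> D |S| exceeds the expected |S||T|/m by the
  factor \<theta> n / |T|, and 1 + x is set equal to this ratio. The exponent thereby contains a
  logarithm of n / |T|, which is what the number of choices of S and T requires; |T| <= |S| / d
  keeps the cost of T proportional to |S|.\<close>

lemma card_event_sparse: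
  assumes S: "S \<subseteq> {..<n}" and T: "T \<subseteq> {..<n}" "T \<noteq> {}" "9 * card T \<le> \<theta> * n"
    and ST: "d * card T \<le> card S"
  shows "card (event S T)
    \<le> card (lifts D m) * (subset_weight n (card S) * subset_weight n (card T))"
proof -
  define s t L where "s = real (card S)" and "t = real (card T)" and "L = ln (\<theta> * n / t)"
  have t: "t > 0" using T finite_subset[OF T(1)] by (auto simp: t_def card_gt_0_iff)
  have s: "s > 0" using ST t a by (smt (verit) mult_pos_pos s_def t_def)
  have n: "real n > 0" using n_pos by simp
  have Y9: "9 \<le> \<theta> * n / t" using T t by (simp add: t_def field_simps)
  \<comment> \<open>The 9 in the density threshold serves to give L >= ln 9 >= 2, hence L - 1 >= L /
    2 below.\<close>
  have "exp (2 :: real) = exp 1 ^ 2" by (simp flip: exp_of_nat_mult)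
  also have "\<dots> \<le> (3 :: real) ^ 2" using exp_le by (intro power_mono) auto
  finally have "2 \<le> ln (9 :: real)" by (subst ln_ge_iff) (auto simp: power2_eq_square)
  also have "\<dots> \<le> L" unfolding L_def using Y9 by (intro ln_mono) auto
  finally have L: "2 \<le> L" .
  have "real (card (event S T)) \<le> card {\<pi> \<in> lifts D m. lift_edges m \<pi> S T \<ge> \<theta> * D * card S}"
    by (intro of_nat_mono card_mono) (auto simp: event_def finite_lifts)
  also have "\<dots> \<le> card (lifts D m) *
      exp ((\<theta> * n / t - 1) * card S * card T / m - \<theta> * D * card S * ln (1 + (\<theta> * n / t - 1)))"
    using m S T Y9 by (intro card_lifts_edges_ge) auto
  also have "\<dots> \<le> card (lifts D m) * exp (- (s * (3 + ln (n / s)) + t * (3 + ln (n / t))))"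
  proof -
    have "(\<theta> * n / t - 1) * s * t / m \<le> (\<theta> * n / t) * s * t / m"
      using s t by (intro divide_right_mono mult_right_mono) auto
    also have "\<dots> = \<theta> * D * s" using t m by (simp add: field_simps)
    finally have "(\<theta> * n / t - 1) * s * t / m - \<theta> * D * s * L \<le> - (\<theta> * D * s * (L - 1))"
      by (simp add: algebra_simps)
    also have "\<dots> \<le> - (\<theta> * D / 2 * (s * L))"
      using mult_left_mono[of "L / 2" "L - 1" "\<theta> * D * s"] \<theta> s L by simp
    also have "\<dots> \<le> - (((1 + 1 / d) * (3 + ln (1 / \<theta>)) + ln (1 / d)) * (s * L))"
      using degree s L by (simp add: mult_right_mono)
    also have "\<dots> \<le> - (s * (3 + ln (n / s)) + t * (3 + ln (n / t)))"
    proof -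
      define l l' where "l = ln (1 / \<theta>)" and "l' = ln (1 / d)"
      have ll': "l \<ge> 0" "l' \<ge> 0" using \<theta> a d by (auto simp: l_def l'_def)
      have "ln (n / t) = ln ((\<theta> * n / t) * (1 / \<theta>))" using \<theta> by simp
      also have "\<dots> = L + l"
        unfolding L_def l_def using \<theta> m D t by (subst ln_mult) auto
      finally have nt: "ln (n / t) = L + l" .
      have "n / s \<le> n / (d * t)"
        using ST s t a n by (intro divide_left_mono mult_pos_pos) (auto simp: s_def t_def)
      then have "n / s \<le> (n / t) * (1 / d)" by (simp add: mult.commute)
      then have "ln (n / s) \<le> ln ((n / t) * (1 / d))"
        using n s by (intro ln_mono) auto
      also have "\<dots> = L + l + l'"
        using m D t a nt by (subst ln_mult) (simp_all add: l'_def)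
      finally have ns: "ln (n / s) \<le> L + l + l'" .
      have "s * (3 + ln (n / s)) + t * (3 + ln (n / t))
          \<le> s * (3 + L + l + l') + (s / d) * (3 + L + l)"
      proof (rule add_mono)
        show "s * (3 + ln (n / s)) \<le> s * (3 + L + l + l')"
          using ns s by (intro mult_left_mono) auto
        have "t \<le> s / d" using ST a by (simp add: s_def t_def pos_le_divide_eq mult.commute)
        then show "t * (3 + ln (n / t)) \<le> (s / d) * (3 + L + l)"
          unfolding nt add.assoc using L ll' by (intro mult_right_mono) auto
      qed
      also have "\<dots> = s * ((1 + 1 / d) * (3 + L + l) + l')"
        by (simp add: algebra_simps)
      also have "\<dots> \<le> s * ((1 + 1 / d) * ((3 + l) * L) + l' * L)"
      proof -
        \<comment> \<open>L >= 2 turns the sum into a product, so that the whole cost becomes a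
          multiple of s L, the form in which \<open>degree\<close> pays for it.\<close>
        have "3 + L + l \<le> (3 + l) * L" "l' \<le> l' * L"
          using L ll' mult_left_mono[of 2 L l] mult_left_mono[of 1 L l'] by (auto simp: algebra_simps)
        then show ?thesis
          using s a by (intro mult_left_mono add_mono) auto
      qed
      finally show ?thesis by (simp add: l_def l'_def algebra_simps)
    qed
    finally show ?thesis
      by (simp add: mult_left_mono s_def t_def L_def)
  qed
  also have "exp (- (s * (3 + ln (n / s)) + t * (3 + ln (n / t))))
      = subset_weight n (card S) * subset_weight n (card T)"
    by (simp add: subset_weight_def s_def t_def flip: exp_add)
  finally show ?thesis .
qed

definition bad_lifts :: "(nat \<times> nat \<Rightarrow> nat \<Rightarrow> nat) set" where
  "bad_lifts = (\<Union>S\<in>{S \<in> Pow {..<n} - {{}}. card S \<le> a * n}. \<Union>T\<in>Pow {..<n}. event S T)"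

text \<open>Dense T spoil at most 1/9 of the lifts and sparse T at most 1/16; both are rounded up to
  1/8. The total of 1/4 leaves room for a second choice of parameters.\<close>

lemma card_bad_lifts: "card bad_lifts \<le> card (lifts D m) / 4"
proof -
  let ?N = "real (card (lifts D m))"
  define Q1 where "Q1 = {(S, T). S \<subseteq> {..<n} \<and> T \<subseteq> {..<n} \<and> card S \<le> a * n \<and> \<theta> * n \<le> 9 * card T}"
  define Q2 where "Q2 = {(S, T) \<in> (Pow {..<n} - {{}}) \<times> (Pow {..<n} - {{}}).
    9 * card T \<le> \<theta> * n \<and> d * card T \<le> card S}"
  have Q1: "Q1 \<subseteq> Pow {..<n} \<times> Pow {..<n}" by (auto simp: Q1_def)
  have Q2: "Q2 \<subseteq> (Pow {..<n} - {{}}) \<times> (Pow {..<n} - {{}})" by (auto simp: Q2_def)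
  have fin: "finite Q1" "finite Q2"
    using finite_subset[OF Q1] finite_subset[OF Q2] by auto
  have fe: "finite (event S T)" for S T by (simp add: event_def finite_lifts)
  have "bad_lifts \<subseteq> (\<Union>(S, T)\<in>Q1 \<union> Q2. event S T)"
  proof
    fix \<pi> assume "\<pi> \<in> bad_lifts"
    then obtain S T where S: "S \<subseteq> {..<n}" "S \<noteq> {}" "card S \<le> a * n" and T: "T \<subseteq> {..<n}"
      and \<pi>: "\<pi> \<in> event S T" by (auto simp: bad_lifts_def)
    \<comment> \<open>S needs edges into T, so T is nonempty; at most D |S| edges leave S, so d |T|
      <= |S|. These are the premises of the sparse bound.\<close>
    have "(S, T) \<in> Q2" if "9 * card T < \<theta> * n"
    proof -
      have l: "lift_edges m \<pi> S T \<le> D * card S"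
        using S T m \<pi> by (intro lift_edges_le) (auto simp: event_def)
      have "0 < \<theta> * D * card S"
        using \<theta> D S finite_subset[OF S(1)] by (auto simp: card_gt_0_iff)
      then have "T \<noteq> {}" using \<pi> by (auto simp: event_def lift_edges_def)
      moreover have "D * (d * card T) \<le> D * card S"
        using \<pi> of_nat_mono[OF l, where 'a = real] by (simp add: event_def mult_ac)
      then have "d * card T \<le> card S" using D by simp
      ultimately show ?thesis using S T that by (auto simp: Q2_def)
    qed
    then have "(S, T) \<in> Q1 \<union> Q2" using S T by (force simp: Q1_def)
    then show "\<pi> \<in> (\<Union>(S, T)\<in>Q1 \<union> Q2. event S T)" using \<pi> by blast
  qed
  then have "card bad_lifts \<le> card (\<Union>(S, T)\<in>Q1 \<union> Q2. event S T)"
    using fin fe by (intro card_mono) auto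
  also have "\<dots> \<le> (\<Sum>(S, T)\<in>Q1 \<union> Q2. card (event S T))"
    using card_UN_le[of "Q1 \<union> Q2" "\<lambda>(S, T). event S T"] fin by (simp add: case_prod_unfold)
  also have "\<dots> \<le> (\<Sum>(S, T)\<in>Q1. card (event S T)) + (\<Sum>(S, T)\<in>Q2. card (event S T))"
    using fin by (simp add: sum_Un_nat)
  finally have "real (card bad_lifts)
      \<le> real (\<Sum>(S, T)\<in>Q1. card (event S T)) + real (\<Sum>(S, T)\<in>Q2. card (event S T))"
    by (simp only: of_nat_le_iff flip: of_nat_add)
  moreover have "real (\<Sum>(S, T)\<in>Q1. card (event S T)) \<le> ?N / 8"
  proof -
    have "real (\<Sum>(S, T)\<in>Q1. card (event S T)) \<le> card Q1 * (?N * exp (- 3 * real n))"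
      unfolding of_nat_sum using card_event_dense
      by (intro sum_bounded_above) (auto simp: Q1_def)
    also have "\<dots> \<le> 4 ^ n * (?N * exp (- 3 * real n))"
    proof (intro mult_right_mono)
      have "card Q1 \<le> 2 ^ n * 2 ^ n"
        using card_mono[OF _ Q1] by (simp add: card_cartesian_product card_Pow)
      also have "\<dots> = 4 ^ n" by (simp flip: power_mult_distrib)
      finally show "real (card Q1) \<le> 4 ^ n" by (metis of_nat_le_iff of_nat_numeral of_nat_power)
    qed auto
    also have "\<dots> = ?N * (4 * exp (- 3)) ^ n"
      by (simp add: power_mult_distrib flip: exp_of_nat_mult)
    also have "\<dots> \<le> ?N * (1 / 3) ^ n"
    proof (intro mult_left_mono power_mono)
      have "(12 :: real) \<le> (1 + 1 + 1 / 2) ^ 3" by (simp add: power3_eq_cube)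
      also have "\<dots> \<le> exp 1 ^ 3"
        using exp_lower_Taylor_quadratic[of 1] by (intro power_mono) auto
      finally have "12 \<le> exp (3 :: real)" by (simp flip: exp_of_nat_mult)
      then show "4 * exp (- 3) \<le> 1 / (3 :: real)" by (simp add: exp_minus divide_simps)
    qed auto
    also have "\<dots> \<le> ?N * (1 / 3) ^ 2"
    proof (intro mult_left_mono power_decreasing)
      show "2 \<le> n" using D m by (metis One_nat_def Suc_1 Suc_leI mult_le_mono nat_mult_1_right)
    qed auto
    finally show ?thesis by (simp add: power2_eq_square)
  qed
  moreover have "real (\<Sum>(S, T)\<in>Q2. card (event S T)) \<le> ?N / 8"
  proof -
    let ?w = "\<lambda>S. subset_weight n (card S)"
    let ?P = "Pow {..<n} - {{}}"
    have w: "?w S \<ge> 0" for S :: "nat set" by (simp add: subset_weight_def)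
    have "real (\<Sum>(S, T)\<in>Q2. card (event S T)) \<le> (\<Sum>(S, T)\<in>Q2. ?N * (?w S * ?w T))"
      unfolding of_nat_sum using card_event_sparse by (intro sum_mono) (auto simp: Q2_def)
    also have "\<dots> \<le> (\<Sum>(S, T)\<in>?P \<times> ?P. ?N * (?w S * ?w T))"
      using Q2 w by (intro sum_mono2) auto
    also have "\<dots> = ?N * ((\<Sum>S\<in>?P. ?w S) * (\<Sum>T\<in>?P. ?w T))"
      unfolding sum_product by (simp add: sum_distrib_left sum.cartesian_product case_prod_unfold)
    also have "\<dots> \<le> ?N * (1 / 4 * (1 / 4))"
      using sum_subset_weight_le[OF n_pos] w by (intro mult_left_mono mult_mono sum_nonneg) auto
    finally show ?thesis by simp
  qed
  ultimately show ?thesis by simp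
qed

end

section \<open>Expanding bipartite graphs\<close>

text \<open>Each choice of parameters excludes at most a quarter of the lifts. The first choice
  serves the minimum distance, the second connectedness.\<close>

lemma exists_expanding_lift:
  assumes "lift_params D m a d \<theta>" "lift_params D m (1 / 2) 1 \<theta>"
  obtains \<pi> where "\<pi> \<in> lifts D m" "\<pi> \<notin> lift_params.bad_lifts D m a d \<theta>"
    "\<pi> \<notin> lift_params.bad_lifts D m (1 / 2) 1 \<theta>"
proof -
  let ?B1 = "lift_params.bad_lifts D m a d \<theta>" and ?B2 = "lift_params.bad_lifts D m (1 / 2) 1 \<theta>"
  have "real (card (lifts D m)) > 0" by (simp add: card_lifts)
  then have "real (card ?B1 + card ?B2) < card (lifts D m)"
    using lift_params.card_bad_lifts[OF assms(1)] lift_params.card_bad_lifts[OF assms(2)] by simp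
  then have lt: "card (?B1 \<union> ?B2) < card (lifts D m)"
    using card_Un_le[of ?B1 ?B2] by linarith
  have "finite (?B1 \<union> ?B2)"
    using assms by (auto simp: lift_params.bad_lifts_def lift_params.event_def finite_lifts)
  then have "\<not> lifts D m \<subseteq> ?B1 \<union> ?B2"
    using lt card_mono by (metis not_le)
  then show thesis using that by blast
qed

text \<open>A vertex has exactly one neighbour in each of the D opposite fibres: the image of its
  position under the permutation, or the preimage when seen from the right.\<close>

lemma card_lift_adj:
  assumes m: "m > 0" and \<pi>: "\<pi> \<in> lifts D m"
  shows card_lift_adj_right: "u < D * m \<Longrightarrow> card {v \<in> {..<D * m}. lift_adj m \<pi> u v} = D"
    and card_lift_adj_left: "v < D * m \<Longrightarrow> card {u \<in> {..<D * m}. lift_adj m \<pi> u v} = D"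
proof -
  have perm: "\<pi> (i, j) permutes {..<m}" if "i < D" "j < D" for i j
    using \<pi> that by (auto simp: lifts_def)
  have bound: "\<pi> (i, j) a < m" "inv_into UNIV (\<pi> (i, j)) a < m" if "i < D" "j < D" "a < m" for i j a
    using permutes_in_image[OF perm[OF that(1,2)], of a] that
      permutes_in_image[OF permutes_inv[OF perm[OF that(1,2)]], of a] by auto
  have lt: "j * m + b < D * m" if "j < D" "b < m" for j b
  proof -
    have "j * m + b < Suc j * m" using that by simp
    also have "\<dots> \<le> D * m" using that by (intro mult_le_mono1) simp
    finally show ?thesis .
  qed
  show "card {v \<in> {..<D * m}. lift_adj m \<pi> u v} = D" if u: "u < D * m"
  proof -
    define i a where "i = u div m" and "a = u mod m"
    have ia: "i < D" "a < m" using u m by (auto simp: i_def a_def less_mult_imp_div_less)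
    have "bij_betw (\<lambda>j. j * m + \<pi> (i, j) a) {..<D} {v \<in> {..<D * m}. lift_adj m \<pi> u v}"
      by (rule bij_betw_byWitness[where f' = "\<lambda>v. v div m"])
        (use ia m bound lt in \<open>auto simp: lift_adj_def i_def[symmetric] a_def[symmetric]
          less_mult_imp_div_less\<close>)
    from bij_betw_same_card[OF this] show ?thesis by simp
  qed
  show "card {u \<in> {..<D * m}. lift_adj m \<pi> u v} = D" if v: "v < D * m"
  proof -
    define j b where "j = v div m" and "b = v mod m"
    have jb: "j < D" "b < m" using v m by (auto simp: j_def b_def less_mult_imp_div_less)
    have 1: "\<pi> (i, j) (inv_into UNIV (\<pi> (i, j)) b) = b" if "i < D" for i
      using permutes_inverses(1)[OF perm[OF that jb(1)]] by simp
    have 2: "inv_into UNIV (\<pi> (i, j)) (\<pi> (i, j) a) = a" if "i < D" for i a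
      using permutes_inverses(2)[OF perm[OF that jb(1)]] by simp
    have "bij_betw (\<lambda>i. i * m + inv_into UNIV (\<pi> (i, j)) b) {..<D} {u \<in> {..<D * m}. lift_adj m \<pi> u v}"
    proof (rule bij_betw_byWitness[where f' = "\<lambda>u. u div m"])
      show "\<forall>u\<in>{u \<in> {..<D * m}. lift_adj m \<pi> u v}. u div m * m + inv_into UNIV (\<pi> (u div m, j)) b = u"
        using 2 by (auto simp: lift_adj_def simp flip: j_def b_def)
          (metis div_mult_mod_eq less_mult_imp_div_less)
    qed (use jb m bound lt 1 in \<open>auto simp: lift_adj_def j_def[symmetric] b_def[symmetric]
          less_mult_imp_div_less\<close>)
    from bij_betw_same_card[OF this] show ?thesis by simp
  qed
qed

lemma lift_edges_eq_sum:
  assumes "finite S" "finite T"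
  shows lift_edges_eq_sum_left: "lift_edges m \<pi> S T = (\<Sum>u\<in>S. card {v \<in> T. lift_adj m \<pi> u v})"
    and lift_edges_eq_sum_right: "lift_edges m \<pi> S T = (\<Sum>v\<in>T. card {u \<in> S. lift_adj m \<pi> u v})"
proof -
  have "{(u, v). u \<in> S \<and> v \<in> T \<and> lift_adj m \<pi> u v} = (SIGMA u:S. {v \<in> T. lift_adj m \<pi> u v})"
    by auto
  then show "lift_edges m \<pi> S T = (\<Sum>u\<in>S. card {v \<in> T. lift_adj m \<pi> u v})"
    using assms by (simp add: lift_edges_def)
  also have "\<dots> = (\<Sum>v\<in>T. card {u \<in> S. lift_adj m \<pi> u v})"
    using assms sum.swap_restrict[of S T "\<lambda>_ _. 1::nat" "lift_adj m \<pi>"] by simp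
  finally show "lift_edges m \<pi> S T = (\<Sum>v\<in>T. card {u \<in> S. lift_adj m \<pi> u v})" .
qed

section \<open>Regularity, connectedness and expansion of a good lift\<close>

lemma card_incident_edges_eq_card_neighbours:
  assumes "\<And>e. e \<in> E \<Longrightarrow> \<exists>x y. e = {x, y}"
  shows "card (incident_edges E u) = card (neighbours E u)"
proof -
  have "incident_edges E u = (\<lambda>w. {u, w}) ` neighbours E u"
  proof (intro equalityI subsetI)
    fix e assume "e \<in> incident_edges E u"
    then have e: "e \<in> E" "u \<in> e" by (auto simp: incident_edges_def)
    then obtain x y where "e = {x, y}" using assms by blast
    then have "\<exists>w. e = {u, w}" using e by auto
    then show "e \<in> (\<lambda>w. {u, w}) ` neighbours E u" using e by (auto simp: neighbours_def)
  qed (auto simp: incident_edges_def neighbours_def)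
  moreover have "inj_on (\<lambda>w. {u, w}) (neighbours E u)"
    by (auto simp: inj_on_def doubleton_eq_iff)
  ultimately show ?thesis by (simp add: card_image)
qed

locale good_lift =
  fixes D m :: nat and \<pi> and a d \<theta> :: real
  assumes params: "lift_params D m a d \<theta>" "lift_params D m (1 / 2) 1 \<theta>"
    and \<pi>: "\<pi> \<in> lifts D m"
    and not_bad: "\<pi> \<notin> lift_params.bad_lifts D m a d \<theta>" "\<pi> \<notin> lift_params.bad_lifts D m (1 / 2) 1 \<theta>"
begin

abbreviation "n \<equiv> D * m"

definition left :: "nat set" where "left = {..<n}"
text \<open>\<open>lift_adj\<close> numbers both sides from 0; the shift by \<open>n\<close> makes
  them disjoint within one vertex type.\<close>

definition right :: "nat set" where "right = {n..<2 * n}"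
definition edges :: "nat set set" where
  "edges = {{u, n + v} | u v. u < n \<and> v < n \<and> lift_adj m \<pi> u v}"

lemma m_pos: "m > 0" and D_gt_1: "D > 1" and \<theta>_le_1: "\<theta> \<le> 1"
  using params(1) by (auto simp: lift_params_def)

lemma n_gt_1: "n > 1"
  using m_pos D_gt_1 less_le_trans[of 1 D "D * m"] by simp

lemma left_right_cases:
  assumes "u \<in> left \<union> right"
  obtains "u < n" | v where "v < n" "u = n + v"
proof (cases "u < n")
  case False
  then have "u - n < n" "u = n + (u - n)" using assms by (auto simp: left_def right_def)
  then show thesis using that by blast
qed (use that in blast)

lemma edge_iff: "u < n \<Longrightarrow> {u, w} \<in> edges \<longleftrightarrow> (\<exists>v<n. w = n + v \<and> lift_adj m \<pi> u v)"
  by (auto simp: edges_def doubleton_eq_iff)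

lemma neighbours_left: "u < n \<Longrightarrow> neighbours edges u = (\<lambda>v. n + v) ` {v \<in> {..<n}. lift_adj m \<pi> u v}"
  by (auto simp: neighbours_def edge_iff)

lemma neighbours_right: "v < n \<Longrightarrow> neighbours edges (n + v) = {u \<in> {..<n}. lift_adj m \<pi> u v}"
  by (auto simp: neighbours_def edges_def doubleton_eq_iff)

lemma card_neighbours: "u \<in> left \<union> right \<Longrightarrow> card (neighbours edges u) = D"
proof -
  assume "u \<in> left \<union> right"
  then consider "u < n" | v where "v < n" "u = n + v"
    by (elim left_right_cases)
  then show ?thesis
  proof cases
    case 1
    then show ?thesis
      using card_lift_adj_right[OF m_pos \<pi>] by (simp add: neighbours_left card_image)
  next
    case 2
    then show ?thesis
      using card_lift_adj_left[OF m_pos \<pi>] by (simp add: neighbours_right)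
  qed
qed

lemma card_incident_edges: "u \<in> left \<union> right \<Longrightarrow> card (incident_edges edges u) = D"
  using card_neighbours[of u] by (subst card_incident_edges_eq_card_neighbours) (auto simp: edges_def)

lemma expansion:
  assumes S: "S \<subseteq> {..<n}" "S \<noteq> {}" and T: "T \<subseteq> {..<n}"
    and eS: "\<theta> * D * card S \<le> lift_edges m \<pi> S T"
  shows "d * D * card T \<le> lift_edges m \<pi> S T \<Longrightarrow> card S > a * n"
    and "D * card T \<le> lift_edges m \<pi> S T \<Longrightarrow> card S > n / 2"
proof -
  have *: "card S > b * n" if p: "lift_params D m b e \<theta>" and nb: "\<pi> \<notin> lift_params.bad_lifts D m b e \<theta>"
    and eT: "e * D * card T \<le> lift_edges m \<pi> S T" for b e :: real
  proof (rule ccontr)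
    assume "\<not> card S > b * n"
    then have "S \<in> {S \<in> Pow {..<n} - {{}}. card S \<le> b * n}" using S by simp
    moreover have "\<pi> \<in> lift_params.event D m e \<theta> S T"
      using \<pi> eS eT by (simp add: lift_params.event_def[OF p])
    ultimately have "\<pi> \<in> lift_params.bad_lifts D m b e \<theta>"
      unfolding lift_params.bad_lifts_def[OF p] using T by blast
    then show False using nb by contradiction
  qed
  show "card S > a * n" if "d * D * card T \<le> lift_edges m \<pi> S T"
    using *[OF params(1) not_bad(1) that] .
  show "card S > n / 2" if "D * card T \<le> lift_edges m \<pi> S T"
    using *[OF params(2) not_bad(2)] of_nat_mono[OF that, where 'a = real] by simp
qed

text \<open>A closed pair is a union of components: all D edges at each of its vertices stay inside.
  Both edge demands therefore hold, even with d = 1, and the second choice of parameters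
  applies.\<close>

lemma closed_pair:
  assumes S: "S \<subseteq> {..<n}" and T: "T \<subseteq> {..<n}"
    and closed: "\<And>u v. u < n \<Longrightarrow> v < n \<Longrightarrow> lift_adj m \<pi> u v \<Longrightarrow> u \<in> S \<longleftrightarrow> v \<in> T"
  shows "card S = card T" "S = {} \<or> card S > n / 2"
proof -
  have fin: "finite S" "finite T" using S T finite_subset by auto
  have "{v \<in> T. lift_adj m \<pi> u v} = {v \<in> {..<n}. lift_adj m \<pi> u v}" if "u \<in> S" for u
    using that S T closed by auto
  then have eS: "lift_edges m \<pi> S T = D * card S"
    unfolding lift_edges_eq_sum_left[OF fin]
    using S card_lift_adj_right[OF m_pos \<pi>] by (simp add: subset_iff cong: sum.cong)
  have "{u \<in> S. lift_adj m \<pi> u v} = {u \<in> {..<n}. lift_adj m \<pi> u v}" if "v \<in> T" for v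
    using that S T closed by auto
  then have eT: "lift_edges m \<pi> S T = D * card T"
    unfolding lift_edges_eq_sum_right[OF fin]
    using T card_lift_adj_left[OF m_pos \<pi>] by (simp add: subset_iff cong: sum.cong)
  show "card S = card T" using eS eT D_gt_1 by simp
  show "S = {} \<or> card S > n / 2"
  proof (cases "S = {}")
    case False
    have "\<theta> * real (D * card S) \<le> 1 * real (D * card S)"
      using \<theta>_le_1 by (intro mult_right_mono) auto
    then have "\<theta> * D * card S \<le> lift_edges m \<pi> S T" by (simp add: eS mult.assoc)
    then show ?thesis using expansion(2)[OF S False T] eT by simp
  qed simp
qed

lemma connected:
  assumes "x \<in> left \<union> right" "y \<in> left \<union> right"
  shows "(x, y) \<in> {(x, y). {x, y} \<in> edges}\<^sup>*"
proof -
  let ?r = "{(x, y). {x, y} \<in> edges}"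
  define C where "C = {y. (x, y) \<in> ?r\<^sup>*}"
  define S T where "S = C \<inter> {..<n}" and "T = {v \<in> {..<n}. n + v \<in> C}"
  have step: "w' \<in> C" if "w \<in> C" "{w, w'} \<in> edges" for w w'
    using that by (auto simp: C_def intro: rtrancl_into_rtrancl)
  have closed: "u \<in> S \<longleftrightarrow> v \<in> T" if "u < n" "v < n" "lift_adj m \<pi> u v" for u v
    using that step[of u "n + v"] step[of "n + v" u]
    by (auto simp: S_def T_def edge_iff insert_commute)
  have ST: "S \<subseteq> {..<n}" "T \<subseteq> {..<n}" by (auto simp: S_def T_def)
  have "x \<in> C" by (simp add: C_def)
  then have "S \<noteq> {} \<or> T \<noteq> {}"
    using assms(1) by (elim left_right_cases) (auto simp: S_def T_def)
  then have "S \<noteq> {}"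
    using closed_pair(1)[OF ST closed] finite_subset[OF ST(2)] by auto
  then have S2: "card S > n / 2"
    using closed_pair(2)[OF ST closed] by auto
  \<comment> \<open>The complement of a component is closed as well. It cannot also contain more
    than half of the left vertices, so it has none.\<close>
  have "card ({..<n} - S) = n - card S"
    using ST by (simp add: card_Diff_subset finite_subset)
  moreover have "card S \<le> n" using card_mono[OF _ ST(1)] by simp
  ultimately have "\<not> card ({..<n} - S) > n / 2"
    using S2 by (simp add: of_nat_diff)
  then have "{..<n} - S = {}"
    using closed_pair(2)[of "{..<n} - S" "{..<n} - T"] closed by auto
  then have S: "S = {..<n}" using ST by auto
  then have "card T = card {..<n}" using closed_pair(1)[OF ST closed] by simp
  then have T: "T = {..<n}" using ST by (intro card_subset_eq) auto
  have "y \<in> C"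
  proof (cases "y < n")
    case True
    then show ?thesis using S by (auto simp: S_def)
  next
    case False
    then have "y - n \<in> T" "n + (y - n) = y" using assms(2) T by (auto simp: left_def right_def)
    then show ?thesis by (auto simp: T_def)
  qed
  then show ?thesis by (simp add: C_def)
qed

lemma bipartite_regular: "bipartite_regular_graph left right edges D"
  unfolding bipartite_regular_graph_def
proof (intro conjI ballI)
  show "\<exists>u\<in>left. \<exists>v\<in>right. e = {u, v}" if "e \<in> edges" for e
    using that by (force simp: edges_def left_def right_def)
qed (use n_gt_1 card_incident_edges connected in \<open>auto simp: left_def right_def\<close>)

lemma no_small_dense_pair:
  assumes S: "S \<subseteq> left" "S \<noteq> {}" and T: "T \<subseteq> right"
    and dS: "\<And>u. u \<in> S \<Longrightarrow> \<theta> * D \<le> card (neighbours edges u \<inter> T)"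
    and dT: "\<And>v. v \<in> T \<Longrightarrow> d * D \<le> card (neighbours edges v \<inter> S)"
  shows "card S > a * card left"
proof -
  define T' where "T' = {v \<in> {..<n}. n + v \<in> T}"
  have T': "T' \<subseteq> {..<n}" by (auto simp: T'_def)
  have S': "S \<subseteq> {..<n}" using S by (simp add: left_def)
  have TT': "T = (\<lambda>v. n + v) ` T'"
  proof -
    have "v = n + (v - n)" "v - n < n" if "v \<in> T" for v
      using subsetD[OF T that] by (auto simp: right_def)
    then show ?thesis by (force simp: T'_def)
  qed
  have fin: "finite S" "finite T'" using S' T' finite_subset by auto
  have "\<theta> * D * card S = (\<Sum>u\<in>S. \<theta> * D)" by simp
  also have "\<dots> \<le> (\<Sum>u\<in>S. real (card {v \<in> T'. lift_adj m \<pi> u v}))"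
  proof (rule sum_mono)
    fix u assume u: "u \<in> S"
    have "neighbours edges u \<inter> T = (\<lambda>v. n + v) ` {v \<in> T'. lift_adj m \<pi> u v}"
      using u S' T' by (subst neighbours_left) (auto simp: TT')
    then show "\<theta> * D \<le> card {v \<in> T'. lift_adj m \<pi> u v}"
      using dS[OF u] by (simp add: card_image)
  qed
  also have "\<dots> = lift_edges m \<pi> S T'"
    by (simp add: lift_edges_eq_sum_left fin)
  finally have eS: "\<theta> * D * card S \<le> lift_edges m \<pi> S T'" .
  have "d * D * card T' = (\<Sum>v\<in>T'. d * D)" by simp
  also have "\<dots> \<le> (\<Sum>v\<in>T'. real (card {u \<in> S. lift_adj m \<pi> u v}))"
  proof (rule sum_mono)
    fix v assume v: "v \<in> T'"
    then have "neighbours edges (n + v) \<inter> S = {u \<in> S. lift_adj m \<pi> u v}"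
      using S' T' by (subst neighbours_right) auto
    then show "d * D \<le> card {u \<in> S. lift_adj m \<pi> u v}"
      using dT[of "n + v"] v by (simp add: TT')
  qed
  also have "\<dots> = lift_edges m \<pi> S T'"
    by (simp add: lift_edges_eq_sum_right fin)
  finally show ?thesis
    using expansion(1)[OF S' S(2) T' eS] by (simp add: left_def)
qed

end

text \<open>The interface between graphs and codes: x and y stand for the numbers of differing edges
  that the constituent distances force at a left and at a right vertex.\<close>

definition expanding :: "real \<Rightarrow> real \<Rightarrow> real \<Rightarrow> 'v set \<Rightarrow> 'v set \<Rightarrow> 'v set set \<Rightarrow> bool" where
  "expanding a x y V1 V2 E \<longleftrightarrow> (\<forall>S T. S \<subseteq> V1 \<and> S \<noteq> {} \<and> T \<subseteq> V2 \<and>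
     (\<forall>u\<in>S. x \<le> card (neighbours E u \<inter> T)) \<and> (\<forall>v\<in>T. y \<le> card (neighbours E v \<inter> S)) \<longrightarrow>
     a * card V1 < card S)"

lemma exists_expander:
  fixes a d \<theta> :: real
  assumes "lift_params D m a d \<theta>" "lift_params D m (1 / 2) 1 \<theta>"
  shows "\<exists>V1 V2 E. bipartite_regular_graph V1 V2 E D \<and> card (V1 :: nat set) = D * m \<and>
    expanding a (\<theta> * D) (d * D) V1 V2 E"
proof -
  obtain \<pi> where "\<pi> \<in> lifts D m" "\<pi> \<notin> lift_params.bad_lifts D m a d \<theta>"
    "\<pi> \<notin> lift_params.bad_lifts D m (1 / 2) 1 \<theta>"
    using exists_expanding_lift[OF assms] by blast
  then interpret good_lift D m \<pi> a d \<theta> using assms by (intro good_lift.intro)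
  have "expanding a (\<theta> * D) (d * D) left right edges"
    unfolding expanding_def by (intro allI impI, elim conjE, rule no_small_dense_pair) auto
  moreover have "card left = D * m" by (simp add: left_def)
  ultimately show ?thesis using bipartite_regular by blast
qed

section \<open>Primes of polynomial size\<close>

lemma multiplicity_eq_sum_dvd:
  assumes "prime (p :: nat)" "n > 0" "n < p ^ Suc L"
  shows "multiplicity p n = (\<Sum>i\<in>{1..L}. if p ^ i dvd n then 1 else 0)"
proof -
  have nu: "\<not> is_unit p" using assms(1) by auto
  have dvd: "p ^ i dvd n \<longleftrightarrow> i \<le> multiplicity p n" for i
    using power_dvd_iff_le_multiplicity[of n p i] assms(2) nu by auto
  have "p ^ multiplicity p n \<le> n" using assms(2) dvd by (intro dvd_imp_le) auto
  then have "p ^ multiplicity p n < p ^ Suc L" using assms(3) by linarith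
  then have "multiplicity p n < Suc L"
    using assms(1) prime_gt_1_nat power_less_imp_less_exp by blast
  then have "{i \<in> {1..L}. i \<le> multiplicity p n} = {1..multiplicity p n}" by auto
  then show ?thesis by (simp add: dvd sum.If_cases Int_def)
qed

text \<open>Legendre's formula, cut off where all later terms vanish. Passing from n to n + 1 raises
  the quotient by p^i exactly when p^i divides n + 1.\<close>

lemma legendre_multiplicity_fact:
  assumes "prime (p :: nat)" "n < p ^ Suc L"
  shows "multiplicity p (fact n) = (\<Sum>i\<in>{1..L}. n div p ^ i)"
  using assms(2)
proof (induction n)
  case (Suc n)
  have "multiplicity p (fact (Suc n) :: nat) = multiplicity p (Suc n) + multiplicity p (fact n :: nat)"
    using assms(1) by (simp add: prime_elem_multiplicity_mult_distrib del: mult_Suc)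
  also have "\<dots> = (\<Sum>i\<in>{1..L}. (if p ^ i dvd Suc n then 1 else 0) + n div p ^ i)"
    using Suc multiplicity_eq_sum_dvd[OF assms(1), of "Suc n" L] by (simp add: sum.distrib)
  also have "\<dots> = (\<Sum>i\<in>{1..L}. Suc n div p ^ i)"
    by (intro sum.cong refl) (simp add: div_Suc dvd_eq_mod_eq_0)
  finally show ?case .
qed simp

text \<open>In Legendre's formula for the binomial coefficient every term, floor(2m/p^i) - 2
  floor(m/p^i), is at most 1, and there are L of them with p^L <= 2m.\<close>

lemma prime_power_multiplicity_central_binomial_le:
  assumes p: "prime (p :: nat)" and m: "m > 0"
  shows "p ^ multiplicity p (2 * m choose m) \<le> 2 * m"
proof -
  have "\<exists>L. p ^ L \<le> 2 * m \<and> 2 * m < p ^ Suc L"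
    using ex_power_ivl1[of p "2 * m"] prime_ge_2_nat[OF p] m by auto
  then obtain L where L: "p ^ L \<le> 2 * m" "2 * m < p ^ Suc L" by blast
  have "(2 * m choose m) * fact m * fact m = (fact (2 * m) :: nat)"
    using binomial_fact_lemma[of m "2 * m"] by (simp add: mult_ac)
  moreover have "(2 * m choose m) \<noteq> 0" by simp
  ultimately have "multiplicity p (fact (2 * m)) =
      multiplicity p (2 * m choose m) + multiplicity p (fact m) + multiplicity p (fact m :: nat)"
    using p by (simp add: prime_elem_multiplicity_mult_distrib flip: \<open>_ = (fact (2 * m) :: nat)\<close>)
  then have "(\<Sum>i\<in>{1..L}. 2 * m div p ^ i)
      = multiplicity p (2 * m choose m) + 2 * (\<Sum>i\<in>{1..L}. m div p ^ i)"
    using legendre_multiplicity_fact[OF p, of "2 * m" L] legendre_multiplicity_fact[OF p, of m L] L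
    by simp
  moreover have "(\<Sum>i\<in>{1..L}. 2 * m div p ^ i) \<le> (\<Sum>i\<in>{1..L}. 2 * (m div p ^ i) + 1)"
  proof (rule sum_mono)
    fix i
    have "0 < p ^ i" using p prime_gt_0_nat by simp
    then have "2 * m < (2 * (m div p ^ i) + 2) * p ^ i"
      using dividend_less_div_times[of "p ^ i" m] by (simp add: algebra_simps)
    then show "2 * m div p ^ i \<le> 2 * (m div p ^ i) + 1"
      by (simp add: less_mult_imp_div_less less_Suc_eq_le[symmetric])
  qed
  moreover have "(\<Sum>i\<in>{1..L}. 2 * (m div p ^ i) + 1) = 2 * (\<Sum>i\<in>{1..L}. m div p ^ i) + L"
    unfolding sum.distrib by (simp add: sum_distrib_left)
  ultimately have "multiplicity p (2 * m choose m) \<le> L" by linarith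
  then have "p ^ multiplicity p (2 * m choose m) \<le> p ^ L"
    using prime_ge_1_nat[OF p] by (intro power_increasing)
  then show ?thesis using L by simp
qed

lemma two_squares_less_four_power: "2 * N\<^sup>2 < (4 :: nat) ^ N"
proof (induction N)
  case (Suc N)
  show ?case
  proof (cases "N = 0")
    case False
    then have "2 * (Suc N)\<^sup>2 \<le> 4 * (2 * N\<^sup>2)"
      by (cases N) (auto simp: power2_eq_square algebra_simps)
    then show ?thesis using Suc by simp
  qed simp
qed simp

text \<open>A weak form of Bertrand's postulate: if all primes up to \<open>2N\<^sup>2\<close> were below \<open>N\<close>, the
  central binomial coefficient at \<open>N\<^sup>2\<close> would have too few prime power factors.\<close>

lemma exists_prime_between:
  assumes "N > 0"
  obtains p :: nat where "prime p" "N \<le> p" "p \<le> 2 * N\<^sup>2"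
proof (rule ccontr)
  assume "\<not> thesis"
  then have small: "p < N" if "prime p" "p \<le> 2 * N\<^sup>2" for p
    using \<open>\<And>p. prime p \<Longrightarrow> N \<le> p \<Longrightarrow> p \<le> 2 * N\<^sup>2 \<Longrightarrow> thesis\<close>[OF that(1) _ that(2)] not_less by blast
  define m where "m = N\<^sup>2"
  define B where "B = (2 * m choose m)"
  have m: "m > 0" using assms by (simp add: m_def)
  have B0: "B \<noteq> 0" by (simp add: B_def)
  have pf: "prime_factors B \<subseteq> {1..<N}"
  proof
    fix p assume p: "p \<in> prime_factors B"
    then have pr: "prime p" and "p dvd B" by auto
    then have "multiplicity p B \<ge> 1"
      using B0 by (intro multiplicity_geI) auto
    then have "p ^ 1 \<le> p ^ multiplicity p B"
      using prime_ge_1_nat[OF pr] by (intro power_increasing)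
    also have "\<dots> \<le> 2 * m"
      unfolding B_def by (rule prime_power_multiplicity_central_binomial_le[OF pr m])
    finally have "p < N" using small[OF pr] by (simp add: m_def)
    then show "p \<in> {1..<N}" using prime_ge_1_nat[OF pr] by simp
  qed
  have "B = (\<Prod>p\<in>prime_factors B. p ^ multiplicity p B)"
    using prod_prime_factors[OF B0] by simp
  also have "\<dots> \<le> (\<Prod>p\<in>prime_factors B. 2 * m)"
    unfolding B_def using m
    by (intro prod_mono) (auto intro: prime_power_multiplicity_central_binomial_le)
  also have "\<dots> = (2 * m) ^ card (prime_factors B)" by simp
  also have "\<dots> \<le> (2 * m) ^ (N - 1)"
    using card_mono[OF _ pf] m by (intro power_increasing) auto
  finally have B: "B \<le> (2 * m) ^ (N - 1)" .
  have "real (4 ^ m) \<le> real (2 * m) * real B"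
    using central_binomial_lower_bound[OF m] m by (simp add: B_def field_simps)
  also have "\<dots> \<le> real (2 * m) * real ((2 * m) ^ (N - 1))"
    using of_nat_mono[OF B, where 'a = real] by (intro mult_left_mono) auto
  also have "\<dots> = real ((2 * m) ^ N)"
    using assms by (cases N) auto
  \<comment> \<open>With m = N^2 both sides are N-th powers, of 4^N and of 2 N^2. The factor 2m lost
    in the lower bound for B is compensated by having only N - 1 possible primes.\<close>
  finally have "4 ^ m \<le> (2 * m) ^ N" by (simp only: of_nat_le_iff)
  moreover have "(2 * m) ^ N < (4 ^ N) ^ N"
    using two_squares_less_four_power[of N] assms by (intro power_strict_mono) (auto simp: m_def)
  ultimately show False by (simp add: m_def power2_eq_square power_mult)
qed

section \<open>MDS codes over prime fields\<close>

text \<open>Writing the unit as \<open>1 mod p\<close> keeps it in the carrier for p = 1, so that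
  the ring axioms hold for every p > 0.\<close>

definition zmod_ring :: "nat \<Rightarrow> nat ring" where
  "zmod_ring p = \<lparr>carrier = {..<p}, monoid.mult = (\<lambda>x y. x * y mod p), one = 1 mod p, zero = 0,
     add = (\<lambda>x y. (x + y) mod p)\<rparr>"

lemma zmod_ring_simps [simp]:
  "carrier (zmod_ring p) = {..<p}"
  "x \<otimes>\<^bsub>zmod_ring p\<^esub> y = x * y mod p" "\<one>\<^bsub>zmod_ring p\<^esub> = 1 mod p"
  "\<zero>\<^bsub>zmod_ring p\<^esub> = 0" "x \<oplus>\<^bsub>zmod_ring p\<^esub> y = (x + y) mod p"
  by (simp_all add: zmod_ring_def)

lemma cring_zmod_ring:
  assumes "p > 0"
  shows "cring (zmod_ring p)"
proof (rule cringI)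
  show "abelian_group (zmod_ring p)"
  proof (rule abelian_groupI)
    fix x assume "x \<in> carrier (zmod_ring p)"
    then show "\<exists>y\<in>carrier (zmod_ring p). y \<oplus>\<^bsub>zmod_ring p\<^esub> x = \<zero>\<^bsub>zmod_ring p\<^esub>"
      using assms by (intro bexI[of _ "(p - x) mod p"]) (auto simp: mod_add_left_eq)
  qed (use assms in \<open>auto simp: mod_add_left_eq mod_add_right_eq add_ac\<close>)
  show "comm_monoid (zmod_ring p)"
    using assms
    by (intro comm_monoidI) (auto simp: mod_mult_left_eq mod_mult_right_eq mult_ac)
qed (auto simp: mod_mult_left_eq mod_add_eq distrib_right)

lemma field_zmod_ring:
  assumes "prime p"
  shows "field (zmod_ring p)"
proof -
  have p: "p > 1" using assms prime_gt_1_nat by blast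
  interpret cring "zmod_ring p" by (rule cring_zmod_ring) (use p in simp)
  have "Units (zmod_ring p) = carrier (zmod_ring p) - {\<zero>\<^bsub>zmod_ring p\<^esub>}"
  proof (intro equalityI subsetI)
    fix x assume x: "x \<in> Units (zmod_ring p)"
    then obtain y where "y * x mod p = 1" using p by (auto simp: Units_def)
    then have "x \<noteq> 0" by (metis mod_0 mult_0_right zero_neq_one)
    then show "x \<in> carrier (zmod_ring p) - {\<zero>\<^bsub>zmod_ring p\<^esub>}" using x by (auto simp: Units_def)
  next
    fix x assume x: "x \<in> carrier (zmod_ring p) - {\<zero>\<^bsub>zmod_ring p\<^esub>}"
    then have "coprime x p"
      using assms by (auto intro!: prime_imp_coprime_nat[THEN coprime_commute[THEN iffD1]] dest: dvd_imp_le)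
    then obtain y where "[x * y = 1] (mod p)" using cong_solve_coprime_nat unfolding One_nat_def by blast
    then have "x * (y mod p) mod p = 1" using p by (simp add: cong_def mod_mult_right_eq)
    then show "x \<in> Units (zmod_ring p)"
      using x p by (auto simp: Units_def mult.commute intro!: bexI[of _ "y mod p"])
  qed
  then show ?thesis by (rule cring_fieldI)
qed

text \<open>The dimension is read off the cardinality, so that no basis of a code has to be exhibited.\<close>

lemma (in vectorspace) card_carrier_eq_power_dim:
  assumes fK: "finite (carrier K)" and fV: "finite (carrier V)"
  shows "card (carrier V) = card (carrier K) ^ dim"
proof -
  have "gen_set (carrier V)"
    using in_own_span[of "carrier V"] span_is_subset2[of "carrier V"] by auto
  then have "fin_dim" using fV unfolding fin_dim_def by blast
  then obtain A where A: "finite A" "basis A" using finite_basis_exists by blast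
  then have AC: "A \<subseteq> carrier V" by (simp add: basis_def)
  have uniq: "\<exists>!a. a \<in> A \<rightarrow>\<^sub>E carrier K \<and> lincomb a A = v" if "v \<in> carrier V" for v
    using basis_criterion[OF A(1) AC] A(2) that by blast
  have "bij_betw (\<lambda>a. lincomb a A) (A \<rightarrow>\<^sub>E carrier K) (carrier V)"
  proof (rule bij_betwI')
    fix a b assume "a \<in> A \<rightarrow>\<^sub>E carrier K" "b \<in> A \<rightarrow>\<^sub>E carrier K"
    moreover from this have "lincomb b A \<in> carrier V" using AC by (intro lincomb_closed) auto
    ultimately show "lincomb a A = lincomb b A \<longleftrightarrow> a = b"
      using uniq by metis
  next
    fix a assume "a \<in> A \<rightarrow>\<^sub>E carrier K"
    then show "lincomb a A \<in> carrier V" using AC by (intro lincomb_closed) auto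
  next
    fix v assume "v \<in> carrier V"
    then show "\<exists>a\<in>A \<rightarrow>\<^sub>E carrier K. v = lincomb a A" using uniq by blast
  qed
  then have "card (A \<rightarrow>\<^sub>E carrier K) = card (carrier V)" by (rule bij_betw_same_card)
  then show ?thesis using A dim_basis[OF A] by (simp add: card_PiE)
qed

text \<open>The bound on the number of roots modulo p, phrased by divisibility of integers. Division
  by x - a leaves a quotient b with one root less, so p divides its coefficients by induction. Its
  top coefficient is that of c; once this term is dropped, the induction hypothesis also covers the
  rest of c.\<close>

lemma poly_coeffs_dvd_if_many_roots:
  fixes c :: "nat \<Rightarrow> int" and p :: int
  assumes "prime p" "finite X" "card X \<ge> k"
    and inc: "\<And>x y. x \<in> X \<Longrightarrow> y \<in> X \<Longrightarrow> p dvd x - y \<Longrightarrow> x = y"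
    and roots: "\<And>x. x \<in> X \<Longrightarrow> p dvd (\<Sum>j<k. c j * x ^ j)"
    and "j < k"
  shows "p dvd c j"
  using assms(2-)
proof (induction k arbitrary: c X j)
  case (Suc k)
  have "X \<noteq> {}" using Suc.prems by auto
  then obtain a where a: "a \<in> X" by blast
  define b where "b i = (\<Sum>l=Suc i..k. c l * a ^ (l - i - 1))" for i
  have diff: "(\<Sum>i\<le>k. c i * x ^ i) - (\<Sum>i\<le>k. c i * a ^ i) = (x - a) * (\<Sum>i<k. b i * x ^ i)" for x
  proof (cases "k = 0")
    case False
    then show ?thesis using polyfun_diff[of k c x a] by (simp add: b_def)
  qed simp
  have bdvd: "p dvd b i" if "i < k" for i
  proof (rule Suc.IH[of "X - {a}"])
    show "p dvd (\<Sum>i<k. b i * x ^ i)" if x: "x \<in> X - {a}" for x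
    proof -
      have "p dvd (\<Sum>i\<le>k. c i * x ^ i) - (\<Sum>i\<le>k. c i * a ^ i)"
        using Suc.prems(4) x a by (intro dvd_diff) (auto simp: lessThan_Suc_atMost)
      then have "p dvd (x - a) * (\<Sum>i<k. b i * x ^ i)" by (simp only: diff)
      moreover have "\<not> p dvd x - a" using Suc.prems(3)[of x a] x a by auto
      ultimately show ?thesis using assms(1) by (simp add: prime_dvd_mult_iff)
    qed
  qed (use Suc.prems a that in auto)
  have lead: "p dvd c k"
  proof (cases k)
    case 0
    then show ?thesis using Suc.prems(4)[OF a] by simp
  next
    case (Suc k')
    then show ?thesis using bdvd[of k'] by (simp add: b_def)
  qed
  show ?case
  proof (cases "j = k")
    case False
    show ?thesis
    proof (rule Suc.IH[of X c])
      show "p dvd (\<Sum>j<k. c j * x ^ j)" if "x \<in> X" for x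
        using Suc.prems(4)[OF that] lead by (simp add: dvd_add_left_iff)
    qed (use Suc.prems False in auto)
  qed (use lead in simp)
qed simp

section \<open>Coordinate spaces and Reed-Solomon codes\<close>

lemma ring_zmod_ring: "p > 0 \<Longrightarrow> ring (zmod_ring p)"
  using cring_zmod_ring cring_def by blast

lemma vec_space_simps:
  assumes "p > 0"
  shows "carrier (vec_space (zmod_ring p) n) = {..<n} \<rightarrow>\<^sub>E {..<p}"
    "x \<oplus>\<^bsub>vec_space (zmod_ring p) n\<^esub> y = (\<lambda>i\<in>{..<n}. (x i + y i) mod p)"
    "c \<odot>\<^bsub>vec_space (zmod_ring p) n\<^esub> x = (\<lambda>i\<in>{..<n}. c * x i mod p)"
    "\<zero>\<^bsub>vec_space (zmod_ring p) n\<^esub> = (\<lambda>i\<in>{..<n}. 0)"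
  by (simp_all add: ring.func_space_def[OF ring_zmod_ring[OF assms]])

lemma vectorspace_vec_space:
  assumes "prime p"
  shows "vectorspace (zmod_ring p) (vec_space (zmod_ring p) n)"
proof -
  have "p > 0" using assms prime_gt_0_nat by blast
  then show ?thesis
    using cring.func_space_is_module[OF cring_zmod_ring] field_zmod_ring[OF assms]
    by (intro vectorspace.intro)
qed

lemma card_vec_space: "p > 0 \<Longrightarrow> card (carrier (vec_space (zmod_ring p) n)) = p ^ n"
  by (simp add: vec_space_simps card_PiE)

text \<open>Reed-Solomon encoding: a polynomial given by its coefficients is evaluated at 0, ..., D
  - 1, which are distinct modulo p when D <= p. Since 0 ^ 0 = 1, the value at 0 is the constant
  coefficient.\<close>

definition rs_encode :: "nat \<Rightarrow> nat \<Rightarrow> nat \<Rightarrow> (nat \<Rightarrow> nat) \<Rightarrow> nat \<Rightarrow> nat" where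
  "rs_encode p D k v = (\<lambda>i\<in>{..<D}. (\<Sum>j<k. v j * i ^ j) mod p)"

definition rs_code :: "nat \<Rightarrow> nat \<Rightarrow> nat \<Rightarrow> (nat \<Rightarrow> nat) set" where
  "rs_code p D k = rs_encode p D k ` carrier (vec_space (zmod_ring p) k)"

text \<open>The dual of a Reed-Solomon code, cut out by r Vandermonde checks. A description by
  checks lets the size of the graph code be bounded by counting syndromes.\<close>

definition parity_code :: "nat \<Rightarrow> nat \<Rightarrow> nat \<Rightarrow> (nat \<Rightarrow> nat) set" where
  "parity_code p D r = {c \<in> {..<D} \<rightarrow>\<^sub>E {..<p}. \<forall>l<r. p dvd (\<Sum>i<D. c i * i ^ l)}"

lemma linear_map_rs_encode:
  assumes "prime p"
  shows "linear_map (zmod_ring p) (vec_space (zmod_ring p) k) (vec_space (zmod_ring p) D)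
    (rs_encode p D k)"
proof -
  have p: "p > 0" using assms prime_gt_0_nat by blast
  have "rs_encode p D k \<in> module_hom (zmod_ring p) (vec_space (zmod_ring p) k) (vec_space (zmod_ring p) D)"
    unfolding module_hom_def
  proof (intro CollectI conjI allI impI)
    show "rs_encode p D k \<in> carrier (vec_space (zmod_ring p) k) \<rightarrow> carrier (vec_space (zmod_ring p) D)"
      using p by (auto simp: vec_space_simps rs_encode_def)
  next
    fix v w
    have "[\<Sum>j<k. (v j + w j) mod p * i ^ j = (\<Sum>j<k. v j * i ^ j) + (\<Sum>j<k. w j * i ^ j)] (mod p)" for i
      unfolding sum.distrib[symmetric] distrib_right[symmetric]
      by (intro cong_sum cong_mult) (auto simp: cong_def)
    then show "rs_encode p D k (v \<oplus>\<^bsub>vec_space (zmod_ring p) k\<^esub> w)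
        = rs_encode p D k v \<oplus>\<^bsub>vec_space (zmod_ring p) D\<^esub> rs_encode p D k w"
      using p by (auto simp: vec_space_simps rs_encode_def cong_def mod_add_eq)
  next
    fix c v
    have "[\<Sum>j<k. (c * v j) mod p * i ^ j = c * (\<Sum>j<k. v j * i ^ j)] (mod p)" for i
      unfolding sum_distrib_left mult.assoc[symmetric]
      by (intro cong_sum cong_mult) (auto simp: cong_def)
    then show "rs_encode p D k (c \<odot>\<^bsub>vec_space (zmod_ring p) k\<^esub> v)
        = c \<odot>\<^bsub>vec_space (zmod_ring p) D\<^esub> rs_encode p D k v"
      using p by (auto simp: vec_space_simps rs_encode_def cong_def mod_mult_right_eq)
  qed
  then show ?thesis
    using vectorspace_vec_space[OF assms]
    by (intro linear_map.intro mod_hom.intro mod_hom_axioms.intro) (auto intro: vectorspace.axioms(1))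
qed

text \<open>The difference of the two message polynomials has degree below k and vanishes at k
  points that are distinct modulo p.\<close>

lemma rs_encode_eqI:
  assumes p: "prime p" and D: "D \<le> p"
    and v: "v \<in> carrier (vec_space (zmod_ring p) k)" and w: "w \<in> carrier (vec_space (zmod_ring p) k)"
    and many: "k \<le> card {i \<in> {..<D}. rs_encode p D k v i = rs_encode p D k w i}"
  shows "v = w"
proof
  fix j
  have p0: "p > 0" using p prime_gt_0_nat by blast
  let ?X = "{i \<in> {..<D}. rs_encode p D k v i = rs_encode p D k w i}"
  show "v j = w j"
  proof (cases "j < k")
    case True
    have "int p dvd int (v j) - int (w j)"
    proof (rule poly_coeffs_dvd_if_many_roots[where c = "\<lambda>j. int (v j) - int (w j)"
          and p = "int p" and X = "int ` ?X" and k = k])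
      show "k \<le> card (int ` ?X)" using many by (simp add: card_image)
      show "int p dvd (\<Sum>j<k. (int (v j) - int (w j)) * x ^ j)" if "x \<in> int ` ?X" for x
      proof -
        obtain i where i: "x = int i" "[\<Sum>j<k. v j * i ^ j = \<Sum>j<k. w j * i ^ j] (mod p)"
          using \<open>x \<in> int ` ?X\<close> by (auto simp: rs_encode_def cong_def)
        then have "[int (\<Sum>j<k. v j * i ^ j) = int (\<Sum>j<k. w j * i ^ j)] (mod int p)"
          by (simp only: cong_int_iff)
        then show ?thesis
          by (simp add: cong_iff_dvd_diff i left_diff_distrib sum_subtractf)
      qed
      show "x = y" if xy: "x \<in> int ` ?X" "y \<in> int ` ?X" "int p dvd x - y" for x y
      proof -
        obtain i i' where i: "x = int i" "y = int i'" "i < p" "i' < p" using xy(1,2) D by auto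
        then have "[i = i'] (mod p)" using xy(3) i by (simp flip: cong_int_iff add: cong_iff_dvd_diff)
        then show ?thesis using i by (simp add: cong_def)
      qed
    qed (use p True in auto)
    then have "[int (v j) = int (w j)] (mod int p)" by (simp add: cong_iff_dvd_diff)
    then have "[v j = w j] (mod p)" by (simp add: cong_int_iff)
    moreover have "v j < p" "w j < p" using v w True p0 by (auto simp: vec_space_simps)
    ultimately show ?thesis by (simp add: cong_def)
  next
    case False
    then show ?thesis using v w p0 by (auto simp: vec_space_simps PiE_def extensional_def)
  qed
qed

lemma inj_on_rs_encode:
  assumes "prime p" "k \<le> D" "D \<le> p"
  shows "inj_on (rs_encode p D k) (carrier (vec_space (zmod_ring p) k))"
proof (rule inj_onI)
  fix v w assume "v \<in> carrier (vec_space (zmod_ring p) k)" "w \<in> carrier (vec_space (zmod_ring p) k)"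
    "rs_encode p D k v = rs_encode p D k w"
  then show "v = w" using assms by (intro rs_encode_eqI[of p D v k w]) auto
qed

lemma rs_code_distance:
  assumes "prime p" "D \<le> p" "x \<in> rs_code p D k" "y \<in> rs_code p D k" "x \<noteq> y"
  shows "D < card {i \<in> {..<D}. x i \<noteq> y i} + k"
proof (rule ccontr)
  assume "\<not> D < card {i \<in> {..<D}. x i \<noteq> y i} + k"
  moreover have "{i \<in> {..<D}. x i = y i} = {..<D} - {i \<in> {..<D}. x i \<noteq> y i}" by auto
  then have "card {i \<in> {..<D}. x i = y i} = D - card {i \<in> {..<D}. x i \<noteq> y i}"
    using card_Diff_subset[of "{i \<in> {..<D}. x i \<noteq> y i}" "{..<D}"] by auto
  ultimately have "k \<le> card {i \<in> {..<D}. x i = y i}" by linarith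
  then show False using assms rs_encode_eqI[OF assms(1,2)] by (auto simp: rs_code_def)
qed

lemma card_rs_code:
  assumes "prime p" "k \<le> D" "D \<le> p"
  shows "card (rs_code p D k) = p ^ k"
  using assms by (simp add: rs_code_def card_image inj_on_rs_encode card_vec_space prime_gt_0_nat)

lemma subspace_rs_code:
  assumes "prime p"
  shows "VectorSpace.subspace (zmod_ring p) (rs_code p D k) (vec_space (zmod_ring p) D)"
proof -
  interpret linear_map "zmod_ring p" "vec_space (zmod_ring p) k" "vec_space (zmod_ring p) D" "rs_encode p D k"
    by (rule linear_map_rs_encode[OF assms])
  show ?thesis using imT_is_subspace by (simp add: im_def rs_code_def)
qed

lemma vectorspace_rs_code:
  assumes "prime p"
  shows "vectorspace (zmod_ring p) (code_space (zmod_ring p) D (rs_code p D k))"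
  by (rule vectorspace.subspace_is_vs[OF vectorspace_vec_space subspace_rs_code]) fact+

lemma dim_rs_code:
  assumes "prime p" "k \<le> D" "D \<le> p"
  shows "vectorspace.dim (zmod_ring p) (code_space (zmod_ring p) D (rs_code p D k)) = k"
proof -
  have p: "p > 1" using assms(1) prime_gt_1_nat by blast
  interpret vectorspace "zmod_ring p" "code_space (zmod_ring p) D (rs_code p D k)"
    by (rule vectorspace_rs_code[OF assms(1)])
  have "finite (rs_code p D k)" using p by (simp add: rs_code_def vec_space_simps finite_PiE)
  then have "p ^ k = p ^ dim"
    using card_carrier_eq_power_dim card_rs_code[OF assms] by simp
  then show ?thesis using p by simp
qed

lemma linear_map_rs_code:
  assumes "prime p"
  shows "linear_map (zmod_ring p) (vec_space (zmod_ring p) k)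
    (code_space (zmod_ring p) D (rs_code p D k)) (rs_encode p D k)"
proof -
  interpret l: linear_map "zmod_ring p" "vec_space (zmod_ring p) k" "vec_space (zmod_ring p) D" "rs_encode p D k"
    by (rule linear_map_rs_encode[OF assms])
  have "rs_encode p D k \<in> module_hom (zmod_ring p) (vec_space (zmod_ring p) k)
      (code_space (zmod_ring p) D (rs_code p D k))"
    using l.f_hom by (auto simp: module_hom_def rs_code_def)
  then show ?thesis
    using vectorspace_vec_space[OF assms] vectorspace_rs_code[OF assms]
    by (intro linear_map.intro mod_hom.intro mod_hom_axioms.intro) (auto intro: vectorspace.axioms(1))
qed

lemma nonzero_linear_code_rs_code:
  assumes "prime p" "0 < k" "k \<le> D" "D \<le> p"
  shows "nonzero_linear_code (zmod_ring p) D (rs_code p D k)"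
proof -
  have "card (rs_code p D k) > 1"
    using assms one_less_power[OF prime_gt_1_nat[OF assms(1)] assms(2)] by (simp add: card_rs_code)
  then show ?thesis
    using subspace_rs_code[OF assms(1)] by (auto simp: nonzero_linear_code_def)
qed

section \<open>Codes given by parity checks\<close>

lemma parity_code_closed:
  assumes "p > 0"
  shows "x \<in> parity_code p D r \<Longrightarrow> y \<in> parity_code p D r \<Longrightarrow>
      (\<lambda>i\<in>{..<D}. (x i + y i) mod p) \<in> parity_code p D r"
    and "x \<in> parity_code p D r \<Longrightarrow> (\<lambda>i\<in>{..<D}. c * x i mod p) \<in> parity_code p D r"
proof -
  assume x: "x \<in> parity_code p D r"
  have "[\<Sum>i<D. (c * x i) mod p * i ^ l = c * (\<Sum>i<D. x i * i ^ l)] (mod p)" for l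
    unfolding sum_distrib_left mult.assoc[symmetric]
    by (intro cong_sum cong_mult) (auto simp: cong_def)
  from cong_dvd_iff[OF this] show "(\<lambda>i\<in>{..<D}. c * x i mod p) \<in> parity_code p D r"
    using x assms by (auto simp: parity_code_def)
  assume y: "y \<in> parity_code p D r"
  have "[\<Sum>i<D. (x i + y i) mod p * i ^ l = (\<Sum>i<D. x i * i ^ l) + (\<Sum>i<D. y i * i ^ l)] (mod p)" for l
    unfolding sum.distrib[symmetric] distrib_right[symmetric]
    by (intro cong_sum cong_mult) (auto simp: cong_def)
  from cong_dvd_iff[OF this] show "(\<lambda>i\<in>{..<D}. (x i + y i) mod p) \<in> parity_code p D r"
    using x y assms by (auto simp: parity_code_def)
qed

lemma subspace_parity_code:
  assumes "prime p"
  shows "VectorSpace.subspace (zmod_ring p) (parity_code p D r) (vec_space (zmod_ring p) D)"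
proof -
  have p: "p > 0" using assms prime_gt_0_nat by blast
  have "submodule (zmod_ring p) (parity_code p D r) (vec_space (zmod_ring p) D)"
  proof (rule submodule.intro)
    show "module (zmod_ring p) (vec_space (zmod_ring p) D)"
      using vectorspace_vec_space[OF assms] vectorspace.axioms(1) by blast
  qed (use p in \<open>auto simp: vec_space_simps parity_code_closed\<close>, auto simp: parity_code_def)
  then show ?thesis
    using vectorspace_vec_space[OF assms] by (simp add: VectorSpace.subspace_def)
qed

text \<open>The difference \<open>x - y\<close> modulo \<open>p\<close>, written without truncated subtraction of residues.\<close>

definition zmod_diff :: "nat \<Rightarrow> nat \<Rightarrow> nat \<Rightarrow> nat" where
  "zmod_diff p x y = (x + (p - 1) * y) mod p"

lemma zmod_diff_less: "p > 0 \<Longrightarrow> zmod_diff p x y < p"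
  by (simp add: zmod_diff_def)

lemma zmod_diff_inj:
  assumes "x < p" "x' < p" "zmod_diff p x y = zmod_diff p x' y"
  shows "x = x'"
proof -
  have "[x + (p - 1) * y = x' + (p - 1) * y] (mod p)"
    using assms(3) by (simp add: zmod_diff_def cong_def)
  then have "[x = x'] (mod p)" by (simp only: cong_add_rcancel_nat)
  then show ?thesis using assms by (simp add: cong_def)
qed

lemma subspace_diff_closed:
  assumes "p > 1" "VectorSpace.subspace (zmod_ring p) C (vec_space (zmod_ring p) D)" "x \<in> C" "y \<in> C"
  shows "(\<lambda>i\<in>{..<D}. zmod_diff p (x i) (y i)) \<in> C"
proof -
  have p: "p > 0" using assms by simp
  interpret submodule "zmod_ring p" C "vec_space (zmod_ring p) D"
    using assms(2) by (simp add: VectorSpace.subspace_def)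
  have "x \<oplus>\<^bsub>vec_space (zmod_ring p) D\<^esub> ((p - 1) \<odot>\<^bsub>vec_space (zmod_ring p) D\<^esub> y) \<in> C"
    using assms by (intro m_closed smult_closed) auto
  then show ?thesis
    using p by (simp add: vec_space_simps zmod_diff_def mod_add_right_eq cong: restrict_cong)
qed

lemma zmod_diff_dvd:
  fixes f g :: "'i \<Rightarrow> nat"
  assumes "p > 0" "(\<Sum>i\<in>I. x i * h i) mod p = (\<Sum>i\<in>I. y i * h i) mod p"
  shows "p dvd (\<Sum>i\<in>I. zmod_diff p (x i) (y i) * h i)"
proof -
  have "[\<Sum>i\<in>I. zmod_diff p (x i) (y i) * h i = (\<Sum>i\<in>I. (x i + (p - 1) * y i) * h i)] (mod p)"
    by (intro cong_sum cong_mult) (auto simp: cong_def zmod_diff_def)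
  also have "(\<Sum>i\<in>I. (x i + (p - 1) * y i) * h i)
      = (\<Sum>i\<in>I. x i * h i) + (p - 1) * (\<Sum>i\<in>I. y i * h i)"
    by (simp add: sum_distrib_left sum.distrib algebra_simps)
  also have "[(\<Sum>i\<in>I. x i * h i) + (p - 1) * (\<Sum>i\<in>I. y i * h i)
      = (\<Sum>i\<in>I. y i * h i) + (p - 1) * (\<Sum>i\<in>I. y i * h i)] (mod p)"
    using assms(2) by (intro cong_add) (auto simp: cong_def)
  also have "(\<Sum>i\<in>I. y i * h i) + (p - 1) * (\<Sum>i\<in>I. y i * h i) = p * (\<Sum>i\<in>I. y i * h i)"
    using assms(1) by (cases p) auto
  finally show ?thesis by (simp add: cong_dvd_iff)
qed

text \<open>Pigeonhole: there are p^D words but only p^r syndromes, so two distinct words share a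
  syndrome and their difference is a nonzero codeword.\<close>

lemma nonzero_linear_code_parity_code:
  assumes p: "prime p" and r: "r < D"
  shows "nonzero_linear_code (zmod_ring p) D (parity_code p D r)"
proof -
  have p1: "p > 1" using p prime_gt_1_nat by blast
  let ?V = "{..<D} \<rightarrow>\<^sub>E {..<p}" and ?W = "{..<r} \<rightarrow>\<^sub>E {..<p}"
  define syn where "syn x = (\<lambda>l\<in>{..<r}. (\<Sum>i<D. x i * i ^ l) mod p)" for x
  have lt: "card ?W < card ?V" using p1 r by (simp add: card_PiE power_strict_increasing)
  have img: "syn ` ?V \<subseteq> ?W"
    unfolding syn_def using p1 by (intro image_subsetI restrict_PiE_iff[THEN iffD2]) simp
  have "\<not> inj_on syn ?V"
  proof
    assume "inj_on syn ?V"
    then have "card ?V \<le> card ?W" by (rule card_inj_on_le[OF _ img]) (simp add: finite_PiE)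
    with lt show False by linarith
  qed
  then obtain x y where xy: "x \<in> ?V" "y \<in> ?V" "x \<noteq> y" "syn x = syn y"
    unfolding inj_on_def by fast
  define z where "z = (\<lambda>i\<in>{..<D}. zmod_diff p (x i) (y i))"
  have "z \<in> parity_code p D r"
    unfolding parity_code_def
  proof (intro CollectI conjI allI impI)
    have "zmod_diff p (x i) (y i) < p" for i using p1 by (intro zmod_diff_less) simp
    then show "z \<in> ?V" unfolding z_def by (intro restrict_PiE_iff[THEN iffD2]) simp
    fix l assume "l < r"
    then have eq: "(\<Sum>i<D. x i * i ^ l) mod p = (\<Sum>i<D. y i * i ^ l) mod p"
      using fun_cong[OF xy(4), of l] by (simp add: syn_def)
    have "p dvd (\<Sum>i<D. zmod_diff p (x i) (y i) * i ^ l)"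
      using p1 by (intro zmod_diff_dvd eq) simp
    then show "p dvd (\<Sum>i<D. z i * i ^ l)" by (simp add: z_def)
  qed
  moreover have "z \<noteq> (\<lambda>i\<in>{..<D}. 0)"
  proof
    assume z0: "z = (\<lambda>i\<in>{..<D}. 0)"
    have "x i = y i" if "i < D" for i
    proof (rule zmod_diff_inj)
      have "y i + (p - 1) * y i = p * y i" using p1 by (cases p) auto
      then have "zmod_diff p (y i) (y i) = 0" by (simp add: zmod_diff_def)
      then show "zmod_diff p (x i) (y i) = zmod_diff p (y i) (y i)"
        using fun_cong[OF z0, of i] that by (simp add: z_def)
    qed (use xy that in auto)
    then have "x = y" using xy(1,2) by (intro PiE_ext) auto
    then show False using xy(3) by simp
  qed
  ultimately have "parity_code p D r \<noteq> {\<zero>\<^bsub>vec_space (zmod_ring p) D\<^esub>}"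
    using p1 by (auto simp: vec_space_simps)
  then show ?thesis using subspace_parity_code[OF p] by (simp add: nonzero_linear_code_def)
qed

text \<open>Test the parity checks against the polynomial vanishing on all but one point of the
  support.\<close>

lemma parity_code_distance:
  assumes p: "prime p" and D: "D \<le> p"
    and x: "x \<in> parity_code p D r" and y: "y \<in> parity_code p D r" and "x \<noteq> y"
  shows "r < card {i \<in> {..<D}. x i \<noteq> y i}"
proof (rule ccontr)
  let ?S = "{i \<in> {..<D}. x i \<noteq> y i}"
  assume small: "\<not> r < card ?S"
  define c where "c i = int (x i) - int (y i)" for i
  have xy: "x \<in> {..<D} \<rightarrow>\<^sub>E {..<p}" "y \<in> {..<D} \<rightarrow>\<^sub>E {..<p}" using x y by (auto simp: parity_code_def)
  have "?S \<noteq> {}" using \<open>x \<noteq> y\<close> PiE_ext[OF xy] by blast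
  then obtain a where a: "a \<in> ?S" by blast
  \<comment> \<open>The degree is |S| - 1 < r, so the checks make the sum of c i * f(i) divisible by
    p. Only the term at a survives, and none of its factors is divisible by p.\<close>
  define f where "f = (\<Prod>j\<in>?S - {a}. [:- int j, 1:])"
  have "degree f \<le> (\<Sum>j\<in>?S - {a}. degree [:- int j, 1:])"
    unfolding f_def by (rule degree_prod_sum_le[THEN order_trans]) auto
  also have "\<dots> = card ?S - 1" using a by simp
  also have "\<dots> < card ?S" using a by (intro diff_less) (auto simp: card_gt_0_iff)
  finally have deg: "degree f < r" using small by simp
  have check: "int p dvd (\<Sum>i<D. c i * int i ^ l)" if "l < r" for l
  proof -
    have "p dvd (\<Sum>i<D. x i * i ^ l)" "p dvd (\<Sum>i<D. y i * i ^ l)"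
      using x y that by (auto simp: parity_code_def)
    then have "int p dvd int (\<Sum>i<D. x i * i ^ l) - int (\<Sum>i<D. y i * i ^ l)"
      by (intro dvd_diff) (simp_all only: int_dvd_int_iff)
    then show ?thesis by (simp add: c_def left_diff_distrib sum_subtractf)
  qed
  have "(\<Sum>i<D. c i * poly f (int i)) = (\<Sum>l\<le>degree f. coeff f l * (\<Sum>i<D. c i * int i ^ l))"
    by (simp add: poly_altdef sum_distrib_left sum.swap[of _ "{..<D}"] mult_ac)
  also have "int p dvd \<dots>"
  proof (rule dvd_sum)
    fix l assume "l \<in> {..degree f}"
    then show "int p dvd coeff f l * (\<Sum>i<D. c i * int i ^ l)"
      using check deg by (intro dvd_mult) simp
  qed
  finally have "int p dvd (\<Sum>i<D. c i * poly f (int i))" .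
  also have "(\<Sum>i<D. c i * poly f (int i)) = (\<Sum>i\<in>{a}. c i * poly f (int i))"
  proof (rule sum.mono_neutral_right)
    show "\<forall>i\<in>{..<D} - {a}. c i * poly f (int i) = 0"
    proof
      fix i assume i: "i \<in> {..<D} - {a}"
      show "c i * poly f (int i) = 0"
      proof (cases "i \<in> ?S")
        case True
        then have "i \<in> ?S - {a}" using i by blast
        then have "poly f (int i) = 0" unfolding f_def poly_prod by (intro prod_zero) auto
        then show ?thesis by simp
      next
        case False
        then show ?thesis using i by (simp add: c_def)
      qed
    qed
  qed (use a in auto)
  finally have "int p dvd c a * (\<Prod>j\<in>?S - {a}. int a - int j)"
    by (simp add: f_def poly_prod)
  then have "int p dvd c a \<or> (\<exists>j\<in>?S - {a}. int p dvd int a - int j)"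
    using p by (auto simp: prime_dvd_mult_iff prime_dvd_prod_iff)
  moreover have neq: "\<not> int p dvd int u - int v" if "u < p" "v < p" "u \<noteq> v" for u v
  proof -
    have "\<not> [u = v] (mod p)" using that by (simp add: cong_def)
    then show ?thesis by (simp flip: cong_int_iff add: cong_iff_dvd_diff)
  qed
  have "\<not> int p dvd c a" unfolding c_def using a xy by (intro neq) auto
  moreover have "\<not> int p dvd int a - int j" if "j \<in> ?S - {a}" for j
    using that a D by (intro neq) auto
  ultimately show False by blast
qed

section \<open>Rate and distance of the folded codes\<close>

text \<open>\<open>k\<close> is the dimension of the left code and \<open>r\<close> the number of
  checks of the right one; r < k makes the designed rate 1 - r/k positive.\<close>

locale regular_code_graph =
  fixes V1 V2 :: "nat set" and E and D p k r :: nat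
  assumes graph: "bipartite_regular_graph V1 V2 E D"
    and p: "prime p" and D_le_p: "D \<le> p" and k: "r < k" "k \<le> D"
begin

abbreviation "F \<equiv> zmod_ring p"
abbreviation "C1 \<equiv> rs_code p D k"
abbreviation "C2 \<equiv> parity_code p D r"
abbreviation "GC \<equiv> graph_code F V1 V2 E C1 C2"
abbreviation "FC \<equiv> folded_code F k (rs_encode p D k) V1 V2 E C1 C2"
abbreviation "nb u \<equiv> sorted_list_of_set (neighbours E u)"

lemma p_gt_1: "p > 1" and p_pos: "p > 0"
  using prime_gt_1_nat[OF p] by auto

lemma finite_V: "finite V1" "finite V2" and card_V: "card V1 = card V2" "card V1 > 1"
  and disjoint: "V1 \<inter> V2 = {}"
  using graph unfolding bipartite_regular_graph_def by blast+

lemma edgeE: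
  assumes "e \<in> E"
  obtains u v where "u \<in> V1" "v \<in> V2" "e = {u, v}"
proof -
  have "\<exists>u\<in>V1. \<exists>v\<in>V2. e = {u, v}"
    using graph assms by (simp add: bipartite_regular_graph_def)
  then show thesis using that by blast
qed

lemma card_incident: "u \<in> V1 \<union> V2 \<Longrightarrow> card (incident_edges E u) = D"
  using graph by (simp add: bipartite_regular_graph_def)

lemma neighbours_subset: "u \<in> V1 \<Longrightarrow> neighbours E u \<subseteq> V2" "u \<in> V2 \<Longrightarrow> neighbours E u \<subseteq> V1"
proof -
  have "u \<in> V1 \<and> w \<in> V2 \<or> u \<in> V2 \<and> w \<in> V1" if w: "w \<in> neighbours E u" for w
  proof -
    have "{u, w} \<in> E" using w by (simp add: neighbours_def)
    then obtain x y where "x \<in> V1" "y \<in> V2" "{u, w} = {x, y}" by (rule edgeE)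
    then show ?thesis by (auto simp: doubleton_eq_iff)
  qed
  then show "u \<in> V1 \<Longrightarrow> neighbours E u \<subseteq> V2" "u \<in> V2 \<Longrightarrow> neighbours E u \<subseteq> V1"
    using disjoint by blast+
qed

lemma finite_neighbours: "u \<in> V1 \<union> V2 \<Longrightarrow> finite (neighbours E u)"
  using finite_subset[OF neighbours_subset(1) finite_V(2)]
    finite_subset[OF neighbours_subset(2) finite_V(1)] by auto

lemma card_neighbours: 
  assumes u: "u \<in> V1 \<union> V2"
  shows "card (neighbours E u) = D"
proof -
  have "\<exists>x y. e = {x, y}" if "e \<in> E" for e using that by (rule edgeE) blast
  then show ?thesis
    using card_incident[OF u] by (simp add: card_incident_edges_eq_card_neighbours)
qed

lemma nb_bij:
  assumes u: "u \<in> V1 \<union> V2"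
  shows "bij_betw (\<lambda>i. nb u ! i) {..<D} (neighbours E u)"
  using bij_betw_nth[of "nb u" "{..<D}" "neighbours E u"] finite_neighbours[OF u] card_neighbours[OF u]
  by simp

lemma nb_edge: "u \<in> V1 \<union> V2 \<Longrightarrow> i < D \<Longrightarrow> {u, nb u ! i} \<in> E"
  using bij_betwE[OF nb_bij, of u] by (auto simp: neighbours_def)

lemma block_eq: "u \<in> V1 \<union> V2 \<Longrightarrow> edge_block E u z = (\<lambda>i\<in>{..<D}. z {u, nb u ! i})"
  by (simp add: edge_block_def card_incident)

lemma ex_nb:
  assumes "e \<in> E"
  obtains u i where "u \<in> V1" "i < D" "e = {u, nb u ! i}"
proof -
  obtain u v where uv: "u \<in> V1" "v \<in> V2" "e = {u, v}" using assms by (rule edgeE)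
  then have "v \<in> neighbours E u" using assms by (simp add: neighbours_def)
  then have "v \<in> (\<lambda>i. nb u ! i) ` {..<D}" using bij_betw_imp_surj_on[OF nb_bij, of u] uv by blast
  then show thesis using that uv by blast
qed

lemma words_eqI:
  assumes "c \<in> extensional E" "c' \<in> extensional E" "\<And>u. u \<in> V1 \<Longrightarrow> edge_block E u c = edge_block E u c'"
  shows "c = c'"
proof (rule extensionalityI[OF assms(1,2)])
  fix e assume "e \<in> E"
  then obtain u i where ui: "u \<in> V1" "i < D" "e = {u, nb u ! i}" by (rule ex_nb)
  show "c e = c' e"
    using fun_cong[OF assms(3)[OF ui(1)], of i] ui by (simp add: block_eq)
qed

text \<open>Words subject to the left constraints alone; the right constraints are accounted for by
  the syndromes of these words.\<close>

definition left_words :: "(nat set \<Rightarrow> nat) set" where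
  "left_words = {z \<in> E \<rightarrow>\<^sub>E {..<p}. \<forall>u\<in>V1. edge_block E u z \<in> C1}"

lemma C1_subset: "C1 \<subseteq> {..<D} \<rightarrow>\<^sub>E {..<p}"
  unfolding rs_code_def rs_encode_def using p_pos
  by (intro image_subsetI restrict_PiE_iff[THEN iffD2]) simp

lemma finite_E: "finite E"
proof (rule finite_subset)
  show "E \<subseteq> Pow (V1 \<union> V2)" using edgeE by blast
qed (use finite_V in auto)

lemma finite_left_words: "finite left_words"
  by (rule finite_subset[of _ "E \<rightarrow>\<^sub>E {..<p}"]) (auto simp: left_words_def finite_E finite_PiE)

lemma GC_subset: "GC \<subseteq> left_words"
  by (auto simp: graph_code_def left_words_def)

text \<open>Every edge has exactly one left end, so the blocks at the left vertices can be chosen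
  independently in the left code.\<close>

lemma card_left_words: "p ^ (k * card V1) \<le> card left_words"
proof -
  define \<phi> where "\<phi> = (\<lambda>(u, i). {u, nb u ! i})"
  have inj: "inj_on \<phi> (V1 \<times> {..<D})"
  proof (rule inj_onI)
    fix x y assume xy: "x \<in> V1 \<times> {..<D}" "y \<in> V1 \<times> {..<D}" "\<phi> x = \<phi> y"
    obtain u i u' i' where ui: "x = (u, i)" "y = (u', i')" by force
    have u: "u \<in> V1" "i < D" "u' \<in> V1" "i' < D" using xy ui by auto
    have "nb u ! i \<in> V2" "nb u' ! i' \<in> V2"
      using bij_betwE[OF nb_bij] neighbours_subset(1) u by blast+
    then have "u = u'" "nb u ! i = nb u ! i'"
      using xy(3) disjoint u by (auto simp: ui \<phi>_def doubleton_eq_iff)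
    moreover have "i = i'"
      using inj_onD[OF bij_betw_imp_inj_on[OF nb_bij, of u], of i i'] \<open>nb u ! i = nb u ! i'\<close> u by simp
    ultimately show "x = y" by (simp add: ui)
  qed
  define word where "word w = (\<lambda>e\<in>E. case inv_into (V1 \<times> {..<D}) \<phi> e of (u, i) \<Rightarrow> w u i)"
    for w :: "nat \<Rightarrow> nat \<Rightarrow> nat"
  have word: "word w {u, nb u ! i} = w u i" if "u \<in> V1" "i < D" for w u i
    using inv_into_f_f[OF inj, of "(u, i)"] that nb_edge[of u i] by (simp add: word_def \<phi>_def)
  have block: "edge_block E u (word w) = w u" if "w \<in> V1 \<rightarrow>\<^sub>E C1" "u \<in> V1" for w u
  proof -
    have "w u \<in> {..<D} \<rightarrow>\<^sub>E {..<p}" using that C1_subset by blast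
    then have "restrict (w u) {..<D} = w u" by (simp add: PiE_def extensional_restrict)
    moreover have "edge_block E u (word w) = restrict (w u) {..<D}"
      using that word by (auto simp: block_eq)
    ultimately show ?thesis by simp
  qed
  have "inj_on word (V1 \<rightarrow>\<^sub>E C1)"
  proof (rule inj_onI)
    fix w w' assume w: "w \<in> V1 \<rightarrow>\<^sub>E C1" "w' \<in> V1 \<rightarrow>\<^sub>E C1" "word w = word w'"
    show "w = w'" using block[OF w(1)] block[OF w(2)] w(3) by (intro PiE_ext[OF w(1,2)]) simp
  qed
  moreover have "word ` (V1 \<rightarrow>\<^sub>E C1) \<subseteq> left_words"
  proof
    fix z assume "z \<in> word ` (V1 \<rightarrow>\<^sub>E C1)"
    then obtain w where w: "w \<in> V1 \<rightarrow>\<^sub>E C1" "z = word w" by blast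
    have "word w e < p" if e: "e \<in> E" for e
    proof -
      obtain u i where ui: "u \<in> V1" "i < D" "e = {u, nb u ! i}" using e by (rule ex_nb)
      have "w u \<in> {..<D} \<rightarrow>\<^sub>E {..<p}" using w ui C1_subset by blast
      then show ?thesis using ui word by auto
    qed
    moreover have "word w \<in> extensional E" by (simp add: word_def)
    ultimately have "word w \<in> E \<rightarrow>\<^sub>E {..<p}" by (auto simp: PiE_def)
    then show "z \<in> left_words" using w block by (auto simp: left_words_def)
  qed
  ultimately have "card (V1 \<rightarrow>\<^sub>E C1) \<le> card left_words"
    using finite_left_words by (rule card_inj_on_le)
  then show ?thesis
    using finite_V p k D_le_p by (simp add: card_PiE card_rs_code power_mult)
qed

text \<open>Words with equal syndromes at the right vertices differ by a codeword.\<close>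

lemma card_left_words_le: "card left_words \<le> p ^ (r * card V1) * card GC"
proof -
  let ?Y = "V2 \<times> {..<r} \<rightarrow>\<^sub>E {..<p}"
  define syn where "syn z = (\<lambda>(v, l)\<in>V2 \<times> {..<r}. (\<Sum>i<D. edge_block E v z i * i ^ l) mod p)" for z
  \<comment> \<open>One representative for each occurring syndrome. Subtracting it moves z into the
    graph code, and z is recovered from its syndrome and this difference.\<close>
  define rep where "rep y = (SOME z. z \<in> left_words \<and> syn z = y)" for y
  have rep: "rep (syn z) \<in> left_words" "syn (rep (syn z)) = syn z" if "z \<in> left_words" for z
    using someI[of "\<lambda>z'. z' \<in> left_words \<and> syn z' = syn z" z] that by (simp_all add: rep_def)
  define diff where "diff z = (\<lambda>e\<in>E. zmod_diff p (z e) (rep (syn z) e))" for z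
  have block: "edge_block E u (diff z)
      = (\<lambda>i\<in>{..<D}. zmod_diff p (edge_block E u z i) (edge_block E u (rep (syn z)) i))"
    if "u \<in> V1 \<union> V2" for u z
    using that nb_edge by (auto simp: block_eq diff_def)
  have diff: "diff z \<in> GC" if z: "z \<in> left_words" for z
    unfolding graph_code_def
  proof (intro CollectI conjI ballI)
    have "zmod_diff p (z e) (rep (syn z) e) < p" for e using p_pos by (rule zmod_diff_less)
    then show "diff z \<in> E \<rightarrow>\<^sub>E carrier F" by (auto simp: diff_def)
    show "edge_block E u (diff z) \<in> C1" if u: "u \<in> V1" for u
      using block[of u z] u z rep[OF z] subspace_diff_closed[OF p_gt_1 subspace_rs_code[OF p]]
      by (auto simp: left_words_def)
    show "edge_block E v (diff z) \<in> C2" if v: "v \<in> V2" for v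
      unfolding parity_code_def
    proof (intro CollectI conjI allI impI)
      have "zmod_diff p a b < p" for a b using p_pos by (rule zmod_diff_less)
      then show "edge_block E v (diff z) \<in> {..<D} \<rightarrow>\<^sub>E {..<p}" using v by (auto simp: block)
      fix l assume l: "l < r"
      have eq: "(\<Sum>i<D. edge_block E v z i * i ^ l) mod p
          = (\<Sum>i<D. edge_block E v (rep (syn z)) i * i ^ l) mod p"
        using fun_cong[OF rep(2)[OF z], of "(v, l)"] v l by (simp add: syn_def)
      have "p dvd (\<Sum>i<D. zmod_diff p (edge_block E v z i) (edge_block E v (rep (syn z)) i) * i ^ l)"
        by (intro zmod_diff_dvd eq p_pos)
      then show "p dvd (\<Sum>i<D. edge_block E v (diff z) i * i ^ l)" using v by (simp add: block)
    qed
  qed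
  have "inj_on (\<lambda>z. (syn z, diff z)) left_words"
  proof (rule inj_onI)
    fix z z' assume zz: "z \<in> left_words" "z' \<in> left_words" "(syn z, diff z) = (syn z', diff z')"
    have syn: "syn z = syn z'" and d: "diff z = diff z'" using zz(3) by simp_all
    have "z e = z' e" if "e \<in> E" for e
    proof (rule zmod_diff_inj)
      show "zmod_diff p (z e) (rep (syn z) e) = zmod_diff p (z' e) (rep (syn z) e)"
        using fun_cong[OF d, of e] that by (simp add: diff_def syn)
    qed (use zz that in \<open>auto simp: left_words_def\<close>)
    then show "z = z'" using zz by (intro PiE_ext[of z E _ z']) (auto simp: left_words_def)
  qed
  moreover have "syn z \<in> ?Y" for z
    unfolding syn_def using p_pos by (intro restrict_PiE_iff[THEN iffD2]) auto
  then have "(\<lambda>z. (syn z, diff z)) ` left_words \<subseteq> ?Y \<times> GC"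
    using diff by blast
  moreover have "finite (?Y \<times> GC)"
    using finite_V finite_subset[OF GC_subset finite_left_words] by (auto intro: finite_PiE)
  ultimately have "card left_words \<le> card (?Y \<times> GC)" by (rule card_inj_on_le)
  also have "\<dots> = p ^ (r * card V1) * card GC"
    using finite_V by (simp add: card_cartesian_product card_PiE card_V mult.commute)
  finally show ?thesis .
qed

lemma inv_encode_eq_iff:
  assumes "x \<in> C1" "y \<in> C1"
  shows "inv_into (alphabet F k) (rs_encode p D k) x = inv_into (alphabet F k) (rs_encode p D k) y \<longleftrightarrow> x = y"
  using assms inv_into_injective[of "alphabet F k" "rs_encode p D k" x y] by (auto simp: rs_code_def)

lemma card_FC: "card FC = card GC"
proof -
  have "inj_on (\<lambda>c. \<lambda>u\<in>V1. inv_into (alphabet F k) (rs_encode p D k) (edge_block E u c)) GC"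
  proof (rule inj_onI)
    fix c c' assume c: "c \<in> GC" "c' \<in> GC"
      and eq: "(\<lambda>u\<in>V1. inv_into (alphabet F k) (rs_encode p D k) (edge_block E u c))
        = (\<lambda>u\<in>V1. inv_into (alphabet F k) (rs_encode p D k) (edge_block E u c'))"
    show "c = c'"
    proof (rule words_eqI)
      fix u assume u: "u \<in> V1"
      have "edge_block E u c \<in> C1" "edge_block E u c' \<in> C1"
        using c u by (auto simp: graph_code_def)
      then show "edge_block E u c = edge_block E u c'"
        using fun_cong[OF eq, of u] u by (simp add: inv_encode_eq_iff)
    qed (use c in \<open>auto simp: graph_code_def PiE_def\<close>)
  qed
  then show ?thesis unfolding folded_code_def by (rule card_image)
qed

lemma is_folded_code_FC: "is_folded_code F k V1 FC"
  unfolding is_folded_code_def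
proof (intro conjI exI)
  show "field F" using p by (rule field_zmod_ring)
  show "nonzero_linear_code F D C1"
    using p k D_le_p by (intro nonzero_linear_code_rs_code) auto
  show "nonzero_linear_code F D C2"
    using p k by (intro nonzero_linear_code_parity_code) auto
  show "vectorspace.dim F (code_space F D C1) = k"
    using p k D_le_p by (intro dim_rs_code) auto
  show "linear_map F (vec_space F k) (code_space F D C1) (rs_encode p D k)"
    using p by (rule linear_map_rs_code)
  show "inj_on (rs_encode p D k) (alphabet F k)"
    using p k D_le_p by (intro inj_on_rs_encode) auto
qed (use graph in auto)

lemma card_FC_ge: "p ^ (k * card V1) \<le> p ^ (r * card V1) * card FC"
  using card_left_words card_left_words_le by (simp add: card_FC)

text \<open>Ensures that the minimum in \<open>rel_min_dist\<close> is taken over a nonempty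
  set.\<close>

lemma card_FC_gt_1: "card FC > 1"
proof -
  have "p ^ (r * card V1) * p ^ card V1 = p ^ (Suc r * card V1)"
    by (simp add: power_add mult.commute)
  also have "\<dots> \<le> p ^ (k * card V1)"
    using k p_pos by (intro power_increasing mult_le_mono1) auto
  also have "\<dots> \<le> p ^ (r * card V1) * card FC" by (rule card_FC_ge)
  finally have "p ^ card V1 \<le> card FC" using p_pos by simp
  moreover have "1 < p ^ card V1" using p_gt_1 card_V by (intro one_less_power) auto
  ultimately show ?thesis by linarith
qed

lemma code_rate_FC: "1 - r / k \<le> code_rate (alphabet F k) V1 FC"
proof -
  define n where "n = real (card V1)"
  have n: "n > 0" using card_V by (simp add: n_def)
  have lp: "ln (real p) > 0" using p_gt_1 by simp
  have k0: "real k > 0" using k by simp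
  have c: "real (card FC) > 0" using card_FC_gt_1 by simp
  have "ln (real (p ^ (k * card V1))) \<le> ln (real (p ^ (r * card V1) * card FC))"
    using card_FC_ge p_pos by (intro ln_mono) (simp_all only: of_nat_le_iff of_nat_0_less_iff, simp)
  then have le: "k * n * ln p \<le> r * n * ln p + ln (card FC)"
    using p_pos c by (simp add: ln_mult ln_realpow n_def)
  have "1 - r / k = (k * n * ln p - r * n * ln p) / (k * ln p * n)"
    using n lp k0 by (simp add: field_simps)
  also have "\<dots> \<le> ln (card FC) / (k * ln p * n)"
    using le n lp k0 by (intro divide_right_mono) auto
  also have "\<dots> = code_rate (alphabet F k) V1 FC"
    using p_pos by (simp add: code_rate_def log_def card_vec_space ln_realpow n_def)
  finally show ?thesis .
qed

text \<open>This settles the distance for R = 1, where the bound 1 - R - \<epsilon> is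
  negative.\<close>

lemma rel_min_dist_nonneg: "0 \<le> rel_min_dist V1 FC"
  by (simp add: rel_min_dist_def)

text \<open>An edge on which two codewords differ makes the blocks at both of its ends differ. The
  constituent distances, at least D - k + 1 on the left and r + 1 on the right, thus become minimum
  degrees between S and T.\<close>

lemma support_distance:
  assumes c: "c \<in> GC" "c' \<in> GC"
    and S: "S = {u \<in> V1. edge_block E u c \<noteq> edge_block E u c'}"
    and T: "T = {v \<in> V2. edge_block E v c \<noteq> edge_block E v c'}"
  shows "u \<in> S \<Longrightarrow> D < card (neighbours E u \<inter> T) + k"
    and "v \<in> T \<Longrightarrow> r < card (neighbours E v \<inter> S)"
proof -
  have le: "card {i \<in> {..<D}. edge_block E u c i \<noteq> edge_block E u c' i} \<le> card (neighbours E u \<inter> A)"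
    if u: "u \<in> V1 \<union> V2" and A: "\<And>w. w \<in> neighbours E u \<Longrightarrow> c {u, w} \<noteq> c' {u, w} \<Longrightarrow> w \<in> A" for u A
  proof (rule card_inj_on_le)
    show "inj_on (\<lambda>i. nb u ! i) {i \<in> {..<D}. edge_block E u c i \<noteq> edge_block E u c' i}"
      using bij_betw_imp_inj_on[OF nb_bij[OF u]] by (rule inj_on_subset) auto
    show "(\<lambda>i. nb u ! i) ` {i \<in> {..<D}. edge_block E u c i \<noteq> edge_block E u c' i} \<subseteq> neighbours E u \<inter> A"
    proof
      fix w assume "w \<in> (\<lambda>i. nb u ! i) ` {i \<in> {..<D}. edge_block E u c i \<noteq> edge_block E u c' i}"
      then obtain i where i: "i < D" "w = nb u ! i" "edge_block E u c i \<noteq> edge_block E u c' i" by auto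
      have "w \<in> neighbours E u" using bij_betwE[OF nb_bij[OF u]] i by auto
      moreover have "c {u, w} \<noteq> c' {u, w}" using i u by (simp add: block_eq)
      ultimately show "w \<in> neighbours E u \<inter> A" using A by auto
    qed
    show "finite (neighbours E u \<inter> A)" using finite_neighbours[OF u] by simp
  qed
  have ne: "edge_block E w c \<noteq> edge_block E w c'"
    if "w \<in> V1 \<union> V2" "u \<in> neighbours E w" "c {u, w} \<noteq> c' {u, w}" for u w
  proof -
    have "u \<in> (\<lambda>i. nb w ! i) ` {..<D}" using bij_betw_imp_surj_on[OF nb_bij[OF that(1)]] that by blast
    then obtain i where "i < D" "u = nb w ! i" by blast
    then have "edge_block E w c i \<noteq> edge_block E w c' i"
      using that(1,3) by (simp add: block_eq insert_commute)
    then show ?thesis by auto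
  qed
  have sym: "w \<in> neighbours E u \<longleftrightarrow> u \<in> neighbours E w" for u w
    by (simp add: neighbours_def insert_commute)
  show "D < card (neighbours E u \<inter> T) + k" if u: "u \<in> S"
  proof -
    have "D < card {i \<in> {..<D}. edge_block E u c i \<noteq> edge_block E u c' i} + k"
      using u c by (intro rs_code_distance[OF p D_le_p]) (auto simp: S graph_code_def)
    moreover have "card {i \<in> {..<D}. edge_block E u c i \<noteq> edge_block E u c' i} \<le> card (neighbours E u \<inter> T)"
      using u ne sym neighbours_subset(1)[of u] by (intro le) (auto simp: S T)
    ultimately show ?thesis by linarith
  qed
  show "r < card (neighbours E v \<inter> S)" if v: "v \<in> T"
  proof -
    have "r < card {i \<in> {..<D}. edge_block E v c i \<noteq> edge_block E v c' i}"
      using v c by (intro parity_code_distance[OF p D_le_p]) (auto simp: T graph_code_def)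
    moreover have "card {i \<in> {..<D}. edge_block E v c i \<noteq> edge_block E v c' i} \<le> card (neighbours E v \<inter> S)"
      using v ne sym neighbours_subset(2)[of v] by (intro le) (auto simp: S T)
    ultimately show ?thesis by linarith
  qed
qed

lemma rel_min_dist_FC:
  fixes a :: real
  assumes expander: "\<And>S T. S \<subseteq> V1 \<Longrightarrow> S \<noteq> {} \<Longrightarrow> T \<subseteq> V2 \<Longrightarrow>
      (\<And>u. u \<in> S \<Longrightarrow> D < card (neighbours E u \<inter> T) + k) \<Longrightarrow>
      (\<And>v. v \<in> T \<Longrightarrow> r < card (neighbours E v \<inter> S)) \<Longrightarrow> card S > a * card V1"
  shows "rel_min_dist V1 FC > a"
proof -
  let ?H = "{hamming_dist V1 x y | x y. x \<in> FC \<and> y \<in> FC \<and> x \<noteq> y}"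
  have fin: "finite ?H"
  proof (rule finite_subset)
    show "?H \<subseteq> {..card V1}"
      using finite_V by (auto simp: hamming_dist_def intro!: card_mono)
  qed simp
  have "?H \<noteq> {}"
  proof -
    obtain x y where "x \<in> FC" "y \<in> FC" "x \<noteq> y"
      using card_FC_gt_1 card_le_Suc0_iff_eq[of FC] card_ge_0_finite[of FC] by force
    then show ?thesis by blast
  qed
  then have "Min ?H \<in> ?H" using fin by (rule Min_in[rotated])
  then obtain x y where xy: "x \<in> FC" "y \<in> FC" "x \<noteq> y" and Min: "Min ?H = hamming_dist V1 x y" by blast
  let ?f = "inv_into (alphabet F k) (rs_encode p D k)"
  obtain c c' where c: "c \<in> GC" "c' \<in> GC" and x: "x = (\<lambda>u\<in>V1. ?f (edge_block E u c))"
    and y: "y = (\<lambda>u\<in>V1. ?f (edge_block E u c'))"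
    using xy(1,2) by (auto simp: folded_code_def)
  define S T where "S = {u \<in> V1. edge_block E u c \<noteq> edge_block E u c'}"
    and "T = {v \<in> V2. edge_block E v c \<noteq> edge_block E v c'}"
  have C1: "edge_block E u c \<in> C1" "edge_block E u c' \<in> C1" if "u \<in> V1" for u
    using c that by (auto simp: graph_code_def)
  have "hamming_dist V1 x y = card S"
    unfolding hamming_dist_def S_def x y
    by (intro arg_cong[of _ _ card] Collect_cong conj_cong refl) (simp add: C1 inv_encode_eq_iff)
  moreover have "S \<noteq> {}"
  proof
    assume "S = {}"
    then have "x = y" unfolding x y S_def by (intro restrict_ext) auto
    then show False using xy(3) by simp
  qed
  then have "card S > a * card V1"
    using support_distance[OF c S_def T_def] by (intro expander[of S T]) (auto simp: S_def T_def)
  ultimately show ?thesis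
    using card_V Min by (simp add: rel_min_dist_def pos_less_divide_eq)
qed

end

section \<open>Choice of parameters\<close>

text \<open>The fibre size m is free, so the degree and the constituent codes stay fixed while the
  length D m grows.\<close>

lemma exists_expander_sequence:
  fixes a d \<theta> :: real
  assumes "\<And>m. m > 0 \<Longrightarrow> lift_params D m a d \<theta>" "\<And>m. m > 0 \<Longrightarrow> lift_params D m (1 / 2) 1 \<theta>"
  shows "\<exists>(V1 :: nat \<Rightarrow> nat set) V2 E. (\<forall>j. bipartite_regular_graph (V1 j) (V2 j) (E j) D) \<and>
    filterlim (\<lambda>j. card (V1 j)) at_top sequentially \<and>
    (\<forall>j. expanding a (\<theta> * D) (d * D) (V1 j) (V2 j) (E j))"
proof -
  have "\<forall>j. \<exists>V1 V2 E. bipartite_regular_graph V1 V2 E D \<and> card (V1 :: nat set) = D * Suc j \<and>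
    expanding a (\<theta> * D) (d * D) V1 V2 E"
    by (intro allI exists_expander assms) simp_all
  then obtain V1 :: "nat \<Rightarrow> nat set" and V2 E
    where P: "\<And>j. bipartite_regular_graph (V1 j) (V2 j) (E j) D" "\<And>j. card (V1 j) = D * Suc j"
      "\<And>j. expanding a (\<theta> * D) (d * D) (V1 j) (V2 j) (E j)"
    by metis
  have "D > 0" using assms(1)[of 1] by (simp add: lift_params_def)
  then have "j \<le> D * Suc j" for j by (cases D) auto
  then have "filterlim (\<lambda>j. D * Suc j) at_top sequentially"
    by (intro filterlim_at_top_mono[OF filterlim_ident] always_eventually allI)
  then have "filterlim (\<lambda>j. card (V1 j)) at_top sequentially" unfolding P(2) .
  with P(1,3) show ?thesis by blast
qed

text \<open>For L = log 2 (1/\<epsilon>) >= 1 one has log p <= 1 + 2 (10 + 3 L) <= 27 L, where 10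
  bounds log 2 801. The constant is 801 * 27 = 21627.\<close>

lemma alphabet_size_bound:
  fixes \<epsilon> :: real and D p k :: nat
  assumes \<epsilon>: "0 < \<epsilon>" "\<epsilon> \<le> 1 / 2" and D: "D > 0" "D \<le> 801 / \<epsilon> ^ 3"
    and p: "p > 0" "p \<le> 2 * D\<^sup>2" and k: "k \<le> D"
  shows "real (p ^ k) \<le> 2 powr (21627 * log 2 (1 / \<epsilon>) / \<epsilon> ^ 3)"
proof -
  define L where "L = log 2 (1 / \<epsilon>)"
  have L: "L \<ge> 1" using \<epsilon> by (simp add: L_def le_log_iff field_simps)
  have "log 2 D \<le> log 2 (801 / \<epsilon> ^ 3)" using D \<epsilon> by (subst log_le_cancel_iff) auto
  also have "\<dots> = log 2 801 + 3 * L"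
    using \<epsilon> by (simp add: L_def log_divide log_nat_power)
  also have "log 2 801 \<le> 10" by (subst log_le_iff) (simp_all add: powr_numeral)
  finally have lD: "log 2 D \<le> 10 + 3 * L" by simp
  have "real p \<le> 2 * (real D)\<^sup>2" using of_nat_mono[OF p(2), where 'a = real] by simp
  then have "log 2 p \<le> log 2 (2 * (real D)\<^sup>2)"
    using p D by (subst log_le_cancel_iff) auto
  also have "\<dots> = 1 + 2 * log 2 D" using D by (simp add: log_mult log_nat_power)
  finally have lp: "log 2 p \<le> 27 * L" using lD L by simp
  have "real (p ^ k) = 2 powr (k * log 2 p)"
    using p by (simp add: powr_mult powr_powr[symmetric] mult.commute[of "real k"] powr_realpow)
  also have "\<dots> \<le> 2 powr ((801 / \<epsilon> ^ 3) * (27 * L))"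
  proof (intro powr_mono mult_mono)
    show "real k \<le> 801 / \<epsilon> ^ 3" using k D by linarith
    show "0 \<le> log 2 p" using p by (simp add: zero_le_log_cancel_iff)
  qed (use lp \<epsilon> in auto)
  also have "(801 / \<epsilon> ^ 3) * (27 * L) = 21627 * L / \<epsilon> ^ 3" by simp
  finally show ?thesis by (simp add: L_def)
qed

text \<open>Since d - a >= 3\<epsilon>/4, the condition \<open>gap\<close> follows from D
  \<epsilon>^3 >= 768, which 800 rounds up. For \<open>degree\<close>, \<epsilon> <= (1 - R)/10
  yields d >= 9\<epsilon>, so its left side is at most (9/4)/\<epsilon>^2, against a right side of
  at least 100/\<epsilon>^2.\<close>

lemma lift_params_small_epsilon:
  fixes R \<epsilon> :: real
  assumes R: "0 < R" "R < 1" and \<epsilon>: "0 < \<epsilon>" "\<epsilon> \<le> (1 - R) / 10" and D: "800 / \<epsilon> ^ 3 \<le> D" and m: "m > 0"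
  shows "lift_params D m (1 - R - \<epsilon>) ((1 - R) * (1 - \<epsilon> / 4)) (\<epsilon> / 4)"
proof -
  define d where "d = (1 - R) * (1 - \<epsilon> / 4)"
  have e10: "\<epsilon> \<le> 1 / 10" using R \<epsilon> by simp
  have "\<epsilon> ^ 3 \<le> 1 ^ 3" using e10 \<epsilon> by (intro power_mono) auto
  then have "800 \<le> 800 / \<epsilon> ^ 3" using \<epsilon> by (simp add: field_simps)
  then have D1: "D > 1" using D by linarith
  have De: "800 \<le> D * \<epsilon> ^ 3" using D \<epsilon> by (simp add: pos_divide_le_eq)
  have d0: "d > 0" using R e10 by (simp add: d_def)
  have gap: "3 / 4 * \<epsilon> \<le> d - (1 - R - \<epsilon>)"
  proof -
    have "(1 - R) * (\<epsilon> / 4) \<le> 1 * (\<epsilon> / 4)" using R \<epsilon> by (intro mult_right_mono) auto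
    then show ?thesis by (simp add: d_def right_diff_distrib)
  qed
  have "108 \<le> D * \<epsilon> ^ 3 * (9 / 64)" using De by simp
  also have "\<dots> = D * (\<epsilon> / 4) * (3 / 4 * \<epsilon>)\<^sup>2" by (simp add: power2_eq_square power3_eq_cube)
  also have "\<dots> \<le> D * (\<epsilon> / 4) * (d - (1 - R - \<epsilon>))\<^sup>2"
    using gap \<epsilon> by (intro mult_left_mono power_mono) auto
  finally have gap2: "108 \<le> D * (\<epsilon> / 4) * (d - (1 - R - \<epsilon>))\<^sup>2" .
  have "9 * \<epsilon> \<le> d"
  proof -
    have "10 * \<epsilon> * (9 / 10) \<le> (1 - R) * (1 - \<epsilon> / 4)"
      using \<epsilon> R e10 by (intro mult_mono) auto
    then show ?thesis by (simp add: d_def)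
  qed
  then have invd: "1 / d \<le> 1 / (9 * \<epsilon>)"
    using \<epsilon> d0 by (intro divide_left_mono) auto
  have "1 \<le> 1 / (9 * \<epsilon>)" using e10 \<epsilon> by (simp add: field_simps)
  then have A: "1 + 1 / d \<le> 1 / (4 * \<epsilon>)" using invd \<epsilon> by (simp add: field_simps)
  have "ln (1 / (\<epsilon> / 4)) \<le> 4 / \<epsilon>" using ln_le_minus_one[of "4 / \<epsilon>"] \<epsilon> by simp
  moreover have "3 \<le> 1 / \<epsilon>" using e10 \<epsilon> by (simp add: field_simps)
  ultimately have B: "3 + ln (1 / (\<epsilon> / 4)) \<le> 5 / \<epsilon>" by (simp add: add_divide_distrib[symmetric])
  have B0: "0 \<le> 3 + ln (1 / (\<epsilon> / 4))" using \<epsilon> e10 by (intro add_nonneg_nonneg ln_ge_zero) (auto simp: field_simps)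
  have "ln (1 / d) \<le> 1 / d" using ln_le_minus_one[of "1 / d"] d0 by simp
  also have "\<dots> \<le> 1 / (9 * \<epsilon>)" by (rule invd)
  also have "\<dots> \<le> 1 / \<epsilon>" using \<epsilon> by (intro divide_left_mono) auto
  also have "\<dots> \<le> 1 / \<epsilon>\<^sup>2" using \<epsilon> e10 by (simp add: field_simps power2_eq_square)
  finally have C: "ln (1 / d) \<le> 1 / \<epsilon>\<^sup>2" .
  have "(1 + 1 / d) * (3 + ln (1 / (\<epsilon> / 4))) \<le> (1 / (4 * \<epsilon>)) * (5 / \<epsilon>)"
    using A B B0 \<epsilon> by (intro mult_mono) auto
  also have "\<dots> = (5 / 4) / \<epsilon>\<^sup>2" by (simp add: power2_eq_square)
  finally have "(1 + 1 / d) * (3 + ln (1 / (\<epsilon> / 4))) + ln (1 / d) \<le> (9 / 4) / \<epsilon>\<^sup>2"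
    using C by (simp add: add_divide_distrib[symmetric])
  also have "\<dots> \<le> \<epsilon> / 4 * D / 2"
  proof -
    have "(9 / 4) / \<epsilon>\<^sup>2 \<le> (800 / 8) / \<epsilon>\<^sup>2" by (intro divide_right_mono) auto
    also have "\<dots> \<le> (D * \<epsilon> ^ 3 / 8) / \<epsilon>\<^sup>2" using De by (intro divide_right_mono) auto
    also have "\<dots> = \<epsilon> / 4 * D / 2" using \<epsilon> by (simp add: power2_eq_square power3_eq_cube)
    finally show ?thesis .
  qed
  finally have deg: "(1 + 1 / d) * (3 + ln (1 / (\<epsilon> / 4))) + ln (1 / d) \<le> \<epsilon> / 4 * D / 2" .
  have "d \<le> 1 * 1" unfolding d_def using R \<epsilon> e10 by (intro mult_mono) auto
  then show ?thesis
    using m D1 R \<epsilon> e10 gap gap2 deg unfolding lift_params_def d_def[symmetric] by auto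
qed

text \<open>Connectedness works with the constant gap 1/2, so the degree chosen for the distance is
  ample.\<close>

lemma lift_params_half:
  fixes \<epsilon> :: real
  assumes \<epsilon>: "0 < \<epsilon>" "\<epsilon> \<le> 1 / 10" and D: "800 / \<epsilon> ^ 3 \<le> D" and m: "m > 0"
  shows "lift_params D m (1 / 2) 1 (\<epsilon> / 4)"
proof -
  have "\<epsilon> ^ 3 \<le> 1 ^ 3" using \<epsilon> by (intro power_mono) auto
  then have "800 \<le> 800 / \<epsilon> ^ 3" using \<epsilon> by (simp add: field_simps)
  then have D1: "D > 1" using D by linarith
  have De: "800 \<le> D * \<epsilon> ^ 3" using D \<epsilon> by (simp add: pos_divide_le_eq)
  have "800 * (1 / \<epsilon>\<^sup>2) \<le> (D * \<epsilon> ^ 3) * (1 / \<epsilon>\<^sup>2)" using De \<epsilon> by (intro mult_right_mono) auto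
  also have "\<dots> = D * \<epsilon>" using \<epsilon> by (simp add: power2_eq_square power3_eq_cube)
  finally have De2: "800 * (1 / \<epsilon>\<^sup>2) \<le> D * \<epsilon>" .
  define x where "x = 1 / \<epsilon>"
  have x: "10 \<le> x" using \<epsilon> by (simp add: x_def field_simps)
  then have "10 * x \<le> x * x" by (intro mult_right_mono) auto
  also have "x * x = 1 / \<epsilon>\<^sup>2" by (simp add: x_def power2_eq_square)
  finally have x2: "8000 * x \<le> D * \<epsilon>" using De2 by linarith
  have "ln (1 / (\<epsilon> / 4)) \<le> 4 * x" using ln_le_minus_one[of "4 / \<epsilon>"] \<epsilon> by (simp add: x_def)
  then have "2 * (3 + ln (1 / (\<epsilon> / 4))) \<le> \<epsilon> / 4 * D / 2" using x2 x by (simp add: mult.commute)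
  moreover have "108 \<le> D * (\<epsilon> / 4) * (1 - 1 / 2)\<^sup>2"
    using x2 x by (simp add: power2_eq_square)
  ultimately show ?thesis using m D1 \<epsilon> unfolding lift_params_def by auto
qed

lemma folded_codes_from_graphs:
  fixes R \<epsilon> :: real and V1 V2 :: "nat \<Rightarrow> nat set"
  assumes graph: "\<And>j. bipartite_regular_graph (V1 j) (V2 j) (E j) D"
    and lim: "filterlim (\<lambda>j. card (V1 j)) at_top sequentially"
    and p: "prime p" "D \<le> p" "p \<le> 2 * D\<^sup>2" and k: "r < k" "k \<le> D"
    and \<epsilon>: "0 < \<epsilon>" "\<epsilon> \<le> 1 / 2" and D: "D \<le> 801 / \<epsilon> ^ 3"
    and rate: "R \<le> 1 - r / k"
    and dist: "\<And>j. rel_min_dist (V1 j) (folded_code (zmod_ring p) k (rs_encode p D k) (V1 j) (V2 j) (E j)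
      (rs_code p D k) (parity_code p D r)) > 1 - R - \<epsilon>"
  shows "\<exists>(F :: nat ring) (k :: nat) (V :: nat \<Rightarrow> nat set) (A :: nat \<Rightarrow> (nat \<Rightarrow> nat \<Rightarrow> nat) set).
     real (card (alphabet F k)) \<le> 2 powr (21627 * log 2 (1 / \<epsilon>) / \<epsilon> ^ 3) \<and>
     filterlim (\<lambda>j. card (V j)) at_top sequentially \<and>
     (\<forall>j. is_folded_code F k (V j) (A j) \<and>
          code_rate (alphabet F k) (V j) (A j) \<ge> R \<and>
          rel_min_dist (V j) (A j) > 1 - R - \<epsilon>)"
proof -
  define A where "A j = folded_code (zmod_ring p) k (rs_encode p D k) (V1 j) (V2 j) (E j)
      (rs_code p D k) (parity_code p D r)" for j
  have loc: "regular_code_graph (V1 j) (V2 j) (E j) D p k r" for j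
    using graph p k by (intro regular_code_graph.intro)
  have "p > 0" "D > 0" using p k prime_gt_0_nat by auto
  then have "real (card (alphabet (zmod_ring p) k)) \<le> 2 powr (21627 * log 2 (1 / \<epsilon>) / \<epsilon> ^ 3)"
    using alphabet_size_bound[OF \<epsilon> _ D _ p(3) k(2)] by (simp add: card_vec_space)
  moreover have "is_folded_code (zmod_ring p) k (V1 j) (A j)" for j
    unfolding A_def by (rule regular_code_graph.is_folded_code_FC[OF loc])
  moreover have "code_rate (alphabet (zmod_ring p) k) (V1 j) (A j) \<ge> R" for j
    unfolding A_def using regular_code_graph.code_rate_FC[OF loc, of j] rate by linarith
  moreover have "rel_min_dist (V1 j) (A j) > 1 - R - \<epsilon>" for j
    unfolding A_def by (rule dist)
  ultimately show ?thesis using lim by blast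
qed

theorem corollary3p4:
  shows "\<exists>K::real. K > 0 \<and>
    (\<forall>R::real. 0 < R \<and> R \<le> 1 \<longrightarrow>
      (\<exists>\<epsilon>\<^sub>0::real. \<epsilon>\<^sub>0 > 0 \<and>
        (\<forall>\<epsilon>::real. 0 < \<epsilon> \<and> \<epsilon> < \<epsilon>\<^sub>0 \<longrightarrow>
          (\<exists>(F :: nat ring) (k :: nat) (V :: nat \<Rightarrow> nat set) (A :: nat \<Rightarrow> (nat \<Rightarrow> nat \<Rightarrow> nat) set).
             real (card (alphabet F k)) \<le> 2 powr (K * log 2 (1 / \<epsilon>) / \<epsilon> ^ 3) \<and>
             filterlim (\<lambda>j. card (V j)) at_top sequentially \<and>
             (\<forall>j. is_folded_code F k (V j) (A j) \<and>
                  code_rate (alphabet F k) (V j) (A j) \<ge> R \<and>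
                  rel_min_dist (V j) (A j) > 1 - R - \<epsilon>)))))"
proof (rule exI[of _ "21627 :: real"], intro conjI allI impI)
  fix R :: real
  assume R: "0 < R \<and> R \<le> 1"
  \<comment> \<open>R = 1 is separated because there the expansion parameters 1 - R - \<epsilon> and
    d would not be positive.\<close>
  define \<epsilon>0 :: real where "\<epsilon>0 = (if R < 1 then (1 - R) / 10 else 1 / 10)"
  show "\<exists>\<epsilon>\<^sub>0::real. \<epsilon>\<^sub>0 > 0 \<and> (\<forall>\<epsilon>::real. 0 < \<epsilon> \<and> \<epsilon> < \<epsilon>\<^sub>0 \<longrightarrow>
    (\<exists>(F :: nat ring) (k :: nat) (V :: nat \<Rightarrow> nat set) (A :: nat \<Rightarrow> (nat \<Rightarrow> nat \<Rightarrow> nat) set).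
       real (card (alphabet F k)) \<le> 2 powr (21627 * log 2 (1 / \<epsilon>) / \<epsilon> ^ 3) \<and>
       filterlim (\<lambda>j. card (V j)) at_top sequentially \<and>
       (\<forall>j. is_folded_code F k (V j) (A j) \<and>
            code_rate (alphabet F k) (V j) (A j) \<ge> R \<and>
            rel_min_dist (V j) (A j) > 1 - R - \<epsilon>)))"
  proof (rule exI[of _ \<epsilon>0], rule conjI, goal_cases)
    case 1
    then show ?case using R by (simp add: \<epsilon>0_def)
  next
    case 2
    show ?case
    proof (rule allI, rule impI)
      fix \<epsilon> :: real
      assume "0 < \<epsilon> \<and> \<epsilon> < \<epsilon>0"
      then have \<epsilon>: "0 < \<epsilon>" "\<epsilon> \<le> 1 / 10" and \<epsilon>R: "R < 1 \<Longrightarrow> \<epsilon> \<le> (1 - R) / 10"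
        using R by (auto simp: \<epsilon>0_def split: if_splits)
      have \<epsilon>2: "\<epsilon> \<le> 1 / 2" using \<epsilon> by simp
      define D where "D = nat \<lceil>800 / \<epsilon> ^ 3\<rceil>"
      have e3: "0 < \<epsilon> ^ 3" "\<epsilon> ^ 3 \<le> 1" using \<epsilon> by (auto intro: power_le_one)
      have Dl: "800 / \<epsilon> ^ 3 \<le> D" unfolding D_def by (rule real_nat_ceiling_ge)
      have e3': "1 \<le> 1 / \<epsilon> ^ 3" using e3 by (simp add: le_divide_eq_1_pos)
      have "D \<le> 800 / \<epsilon> ^ 3 + 1" unfolding D_def using e3 by (simp add: of_nat_nat)
      also have "\<dots> \<le> 800 / \<epsilon> ^ 3 + 1 / \<epsilon> ^ 3" using e3' by (rule add_left_mono)
      also have "\<dots> = 801 / \<epsilon> ^ 3" by (simp flip: add_divide_distrib)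
      finally have Du: "D \<le> 801 / \<epsilon> ^ 3" .
      have "0 < 800 / \<epsilon> ^ 3" using e3 by simp
      then have D0: "D > 0" using Dl by linarith
      obtain p where p: "prime p" "D \<le> p" "p \<le> 2 * D\<^sup>2"
        using exists_prime_between[OF D0] by blast
      have half: "lift_params D m (1 / 2) 1 (\<epsilon> / 4)" if "m > 0" for m
        using \<epsilon> Dl that by (rule lift_params_half)
      show "\<exists>(F :: nat ring) (k :: nat) (V :: nat \<Rightarrow> nat set) (A :: nat \<Rightarrow> (nat \<Rightarrow> nat \<Rightarrow> nat) set).
         real (card (alphabet F k)) \<le> 2 powr (21627 * log 2 (1 / \<epsilon>) / \<epsilon> ^ 3) \<and>
         filterlim (\<lambda>j. card (V j)) at_top sequentially \<and>
         (\<forall>j. is_folded_code F k (V j) (A j) \<and>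
              code_rate (alphabet F k) (V j) (A j) \<ge> R \<and>
              rel_min_dist (V j) (A j) > 1 - R - \<epsilon>)"
      proof (cases "R < 1")
        case False
        then have R1: "R = 1" using R by simp
        \<comment> \<open>For R = 1 the left code is the full space (k = D) and the right code has
          no checks (r = 0), so the rate bound is 1.\<close>
        obtain V1 V2 :: "nat \<Rightarrow> nat set" and E where
          graph: "\<And>j. bipartite_regular_graph (V1 j) (V2 j) (E j) D"
          and lim: "filterlim (\<lambda>j. card (V1 j)) at_top sequentially"
          using exists_expander_sequence[OF half half] by blast
        have "rel_min_dist (V1 j) (folded_code (zmod_ring p) D (rs_encode p D D) (V1 j) (V2 j) (E j)
            (rs_code p D D) (parity_code p D 0)) > 1 - R - \<epsilon>" for j
          using regular_code_graph.rel_min_dist_nonneg[OF regular_code_graph.intro[OF graph p(1,2) D0 order_refl], of j]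
            R1 \<epsilon> by simp
        then show ?thesis
          using R1 by (intro folded_codes_from_graphs[OF graph lim p D0 order_refl \<epsilon>(1) \<epsilon>2 Du]) auto
      next
        case True
        define \<theta> d where "\<theta> = \<epsilon> / 4" and "d = (1 - R) * (1 - \<theta>)"
        \<comment> \<open>Both roundings are harmless because the constituent distances exceed by
          one the amount subtracted: D - k + 1 > \<theta> D on the left, and r + 1 > (1 - R) k >= d
          D on the right, while r <= (1 - R) k keeps the rate.\<close>
        define k where "k = D - nat \<lfloor>\<theta> * D\<rfloor>"
        define r where "r = nat \<lfloor>(1 - R) * k\<rfloor>"
        have params: "lift_params D m (1 - R - \<epsilon>) d \<theta>" if "m > 0" for m
          unfolding d_def \<theta>_def using R True \<epsilon> \<epsilon>R Dl that by (intro lift_params_small_epsilon) auto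
        obtain V1 V2 :: "nat \<Rightarrow> nat set" and E where
          graph: "\<And>j. bipartite_regular_graph (V1 j) (V2 j) (E j) D"
          and lim: "filterlim (\<lambda>j. card (V1 j)) at_top sequentially"
          and expander: "\<And>j. expanding (1 - R - \<epsilon>) (\<theta> * D) (d * D) (V1 j) (V2 j) (E j)"
          using exists_expander_sequence[OF params half[folded \<theta>_def]] by blast
        have \<theta>: "0 < \<theta>" "\<theta> < 1" using \<epsilon> by (auto simp: \<theta>_def)
        have fl: "real (nat \<lfloor>\<theta> * D\<rfloor>) \<le> \<theta> * D" using \<theta> by (simp add: of_nat_nat)
        moreover have "\<theta> * D < 1 * real D" using \<theta> D0 by (intro mult_strict_right_mono) auto
        ultimately have flD: "nat \<lfloor>\<theta> * D\<rfloor> < D" by linarith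
        have kD: "k \<le> D" and k0: "k > 0" using flD by (auto simp: k_def)
        have kl: "(1 - \<theta>) * D \<le> k" using fl flD by (simp add: k_def of_nat_diff algebra_simps)
        have rl: "real r \<le> (1 - R) * k" using True by (simp add: r_def of_nat_nat)
        have "(1 - R) * k < 1 * real k" using R k0 by (intro mult_strict_right_mono) auto
        then have rk: "r < k" using rl by linarith
        have rate: "R \<le> 1 - r / k" using rl k0 by (simp add: field_simps)
        have c1: "\<theta> * D \<le> c" if "D < c + k" for c :: nat
        proof -
          have "nat \<lfloor>\<theta> * D\<rfloor> < c" using that flD by (simp add: k_def)
          then show ?thesis by linarith
        qed
        have c2: "d * D \<le> c" if "r < c" for c :: nat
        proof -
          have "d * D = (1 - R) * ((1 - \<theta>) * D)" by (simp add: d_def)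
          also have "\<dots> \<le> (1 - R) * k" using True kl by (intro mult_left_mono) auto
          also have "\<dots> \<le> c" using that unfolding r_def by linarith
          finally show ?thesis .
        qed
        have "rel_min_dist (V1 j) (folded_code (zmod_ring p) k (rs_encode p D k) (V1 j) (V2 j) (E j)
            (rs_code p D k) (parity_code p D r)) > 1 - R - \<epsilon>" for j
        proof (rule regular_code_graph.rel_min_dist_FC)
          show "regular_code_graph (V1 j) (V2 j) (E j) D p k r"
            using graph p rk kD by (intro regular_code_graph.intro)
          fix S T
          assume S: "S \<subseteq> V1 j" "S \<noteq> {}" "T \<subseteq> V2 j"
            "\<And>u. u \<in> S \<Longrightarrow> D < card (neighbours (E j) u \<inter> T) + k"
            "\<And>v. v \<in> T \<Longrightarrow> r < card (neighbours (E j) v \<inter> S)"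
          have "\<forall>u\<in>S. \<theta> * D \<le> card (neighbours (E j) u \<inter> T)"
            "\<forall>v\<in>T. d * D \<le> card (neighbours (E j) v \<inter> S)"
            using c1[OF S(4)] c2[OF S(5)] by auto
          with S(1-3) show "card S > (1 - R - \<epsilon>) * card (V1 j)"
            by (intro expander[of j, unfolded expanding_def, rule_format, of S T] conjI)
        qed
        then show ?thesis
          by (intro folded_codes_from_graphs[OF graph lim p rk kD \<epsilon>(1) \<epsilon>2 Du rate])
      qed
    qed
  qed
qed simp

end
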